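(* Let $\{X(t);t\ge 0\}$ be a (regular) weighted Markov branching process with $X(0)=1$, let $\mathbb{N}\subset\mathbb{Z}_+$ be a finite subset with $1\notin\mathbb{N}$ and $b_k>0$ for all $k\in\mathbb{N}$, and put $N=|\mathbb{N}|$. Let $\tau=\inf\{t\ge 0: X(t)=0\}$. Then the probability generating function $G(\mathbf{v})$ of the $(\mathbb{N}-1)$-range crossing numbers $\mathbf{Y}(\tau)=(Y_k(\tau);k\in\mathbb{N})$ conditioned on $\tau<\infty$ is given by $$G(\mathbf{v})=\rho^{-1}\sum_{\mathbf{l}\in\mathbb{Z}_+^N}\rho_{\mathbf{l}}\,\mathbf{v}^{\mathbf{l}},\qquad \mathbf{v}\in[0,1]^N,$$ where $\rho$ is the minimal nonnegative root of $B(u)=0$, $\rho_{\mathbf{0}}$ is the minimal nonnegative root of $\bar B_{\mathbb{N}}(u)=0$, and $\rho_{\mathbf{l}}$ $(\mathbf{l}\ne\mathbf{0})$ are given by the following recursion: $$\rho_{\mathbf{l}+\mathbf{e}_k}=-\frac{\displaystyle\sum_{j\in\mathbb{N}^c\setminus\{1\}}b_j\sum_{\substack{\mathbf{l}^{(1)}+\cdots+\mathbf{l}^{(j)}=\mathbf{l}+\mathbf{e}_k\\ \mathbf{l}^{(1)}\cdot\mathbf{1},\dots,\mathbf{l}^{(j)}\cdot\mathbf{1}\le\mathbf{l}\cdot\mathbf{1}}}\rho_{\mathbf{l}^{(1)}}\cdots\rho_{\mathbf{l}^{(j)}}+b_k\,\rho^{*(k)}_{\mathbf{l}}}{\bar B_{\mathbb{N}}'(\rho_{\mathbf{0}})},\qquad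 k\in\mathbb{N}.$$
   Context: $\mathbb{Z}_+=\{0,1,2,\dots\}$. Fix real numbers $b_j$ $(j\ge 0)$ and $w_i$ $(i\ge 1)$ with $b_j\ge 0$ for $j\ne 1$, $0<-b_1=\sum_{j\ne 1}b_j<\infty$, and $w_i>0$. The weighted branching $Q$-matrix is $q_{ij}=w_ib_{j-i+1}$ if $i\ge 1$, $j\ge i-1$, and $q_{ij}=0$ otherwise $(i,j\in\mathbb{Z}_+)$. A weighted Markov branching process $X(t)$ is the continuous-time Markov chain on $\mathbb{Z}_+$ with this $Q$-matrix; it is assumed regular (non-explosive). State $0$ is absorbing. For $k\in\mathbb{N}$, $Y_k(t)$ is the number of jumps of size $k-1$ (transitions from some $i\ge1$ to $i+k-1$) made by $X$ during $[0,t]$, with $Y_k(0)=0$; $Y_k(\tau)$ is the total number of such jumps until extinction (the $(k-1)$-range crossing number). Vectors in $\mathbb{Z}_+^N$ or $[0,1]^N$ are indexed by $\mathbb{N}$; in the recursion $\mathbf{l}\in\mathbb{Z}_+^N$; $\mathbf{e}_k$ is the unit vector with $1$ in coordinate $k$; $\mathbf{v}^{\mathbf{l}}=\prod_{k\in\mathbb{N}}v_k^{l_k}$; $\mathbf{l}\cdot\mathbf{1}=\sum_{k\in\mathbb{N}}l_k$; $\mathbb{N}^c=\mathbb{Z}_+\setminus\mathbb{N}$. $B(u)=\sum_{j\ge 0}b_ju^j$ and $\bar B_{\mathbb{N}}(u)=\sum_{j\in\mathbb{N}^c}b_ju^j$ for $u\in[0,1]$. Convolution powers of $\{\rho_{\mathbf{l}}\}$: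 $\rho^{*(0)}_{\mathbf{0}}=1$, $\rho^{*(0)}_{\mathbf{l}}=0$ for $\mathbf{l}\ne\mathbf{0}$, and $\rho^{*(j)}_{\mathbf{l}}=\sum_{\mathbf{l}^{(1)}+\cdots+\mathbf{l}^{(j)}=\mathbf{l}}\rho_{\mathbf{l}^{(1)}}\cdots\rho_{\mathbf{l}^{(j)}}$ for $j\ge1$. For $j=0$ the inner sum in the recursion is empty, hence $0$.
   Formalization: The printed recursion is inconsistent if N has two or more elements and b_0>0; its last term is replaced by the sum of b_m ρ^{*(m)} at l+e_k−e_m over all m in the support of l+e_k (same if |N|≤1). Path regularity is assumed for every sample path. *)

theory Defs
  imports "HOL-Probability.Probability" "HOL-Library.Poly_Mapping"
begin

section \<open>Continuous-time Markov chains on the natural numbers\<close>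

definition Q_function :: "(nat \<Rightarrow> nat \<Rightarrow> real) \<Rightarrow> (real \<Rightarrow> nat \<Rightarrow> nat \<Rightarrow> real) \<Rightarrow> bool" where
  "Q_function Q p \<longleftrightarrow>
     (\<forall>t\<ge>0. \<forall>i j. 0 \<le> p t i j) \<and>
     (\<forall>t\<ge>0. \<forall>i. (\<lambda>j. p t i j) sums 1) \<and>
     (\<forall>i j. p 0 i j = (if i = j then 1 else 0)) \<and>
     (\<forall>s\<ge>0. \<forall>t\<ge>0. \<forall>i k. (\<lambda>j. p s i j * p t j k) sums p (s + t) i k) \<and>
     (\<forall>i j. ((\<lambda>t. p t i j) has_real_derivative Q i j) (at 0 within {0..}))"

text \<open>
  Paths are functions on the real line of which only the values at nonnegative times matter.
  Their values lie in the discrete space of natural numbers, so continuity means being locally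
  constant.
\<close>

definition jump_times :: "(real \<Rightarrow> nat) \<Rightarrow> real set" where
  "jump_times x = {s. 0 < s \<and> \<not> isCont x s}"

text \<open>
  Regularity (non-explosion) is the requirement that every path has only finitely many jumps in
  every bounded time interval. It is imposed on all paths, not almost all, so that
  the jump counts below are measurable.
\<close>

locale regular_ctmc = prob_space M
  for M :: "'a measure" +
  fixes Q :: "nat \<Rightarrow> nat \<Rightarrow> real"
    and p :: "real \<Rightarrow> nat \<Rightarrow> nat \<Rightarrow> real"
    and X :: "real \<Rightarrow> 'a \<Rightarrow> nat"
  assumes Q_function: "Q_function Q p"
    and measurable_X: "\<And>t. 0 \<le> t \<Longrightarrow> X t \<in> M \<rightarrow>\<^sub>M count_space UNIV"
    and markov: "\<And>(t :: nat \<Rightarrow> real) (i :: nat \<Rightarrow> nat) n.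
        0 \<le> t 0 \<Longrightarrow> (\<And>m. m < n \<Longrightarrow> t m \<le> t (Suc m)) \<Longrightarrow>
        prob {\<omega> \<in> space M. \<forall>m\<le>n. X (t m) \<omega> = i m} =
          prob {\<omega> \<in> space M. X (t 0) \<omega> = i 0} *
          (\<Prod>m<n. p (t (Suc m) - t m) (i m) (i (Suc m)))"
    and right_continuous:
      "\<And>\<omega> t. \<omega> \<in> space M \<Longrightarrow> 0 \<le> t \<Longrightarrow> continuous (at_right t) (\<lambda>s. X s \<omega>)"
    and non_explosive:
      "\<And>\<omega> t. \<omega> \<in> space M \<Longrightarrow> finite (jump_times (\<lambda>s. X s \<omega>) \<inter> {..t})"


section \<open>Weighted branching and range crossing numbers\<close>

definition weighted_branching_params :: "(nat \<Rightarrow> real) \<Rightarrow> (nat \<Rightarrow> real) \<Rightarrow> bool" where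
  "weighted_branching_params b w \<longleftrightarrow>
     (\<forall>j. j \<noteq> 1 \<longrightarrow> 0 \<le> b j) \<and> 0 < - b 1 \<and>
     (\<lambda>j. if j = 1 then 0 else b j) sums (- b 1) \<and>
     (\<forall>i\<ge>1. 0 < w i)"

definition weighted_branching_Q :: "(nat \<Rightarrow> real) \<Rightarrow> (nat \<Rightarrow> real) \<Rightarrow> nat \<Rightarrow> nat \<Rightarrow> real" where
  "weighted_branching_Q b w i j = (if 1 \<le> i \<and> i \<le> j + 1 then w i * b (j + 1 - i) else 0)"

definition extinction_time :: "(real \<Rightarrow> nat) \<Rightarrow> ereal" where
  "extinction_time x = (INF t\<in>{t. 0 \<le> t \<and> x t = 0}. ereal t)"

text \<open>
  The number of transitions from some \<open>i \<ge> 1\<close> to \<open>i + k - 1\<close> up to time \<open>T\<close>; the state from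
  which the path jumps is its left limit. The value is junk if \<open>T = \<infinity>\<close> and there are
  infinitely many such jumps.
\<close>

definition crossing_number :: "nat \<Rightarrow> (real \<Rightarrow> nat) \<Rightarrow> ereal \<Rightarrow> nat" where
  "crossing_number k x T =
     card {s \<in> jump_times x. ereal s \<le> T \<and> (\<exists>i\<ge>1. (x \<longlongrightarrow> i) (at_left s) \<and> x s = i + k - 1)}"

definition crossing_pgf ::
    "'a measure \<Rightarrow> (real \<Rightarrow> 'a \<Rightarrow> nat) \<Rightarrow> nat set \<Rightarrow> (nat \<Rightarrow> real) \<Rightarrow> real" where
  "crossing_pgf M X N v =
     (\<integral>\<omega>. (\<Prod>k\<in>N. v k ^ crossing_number k (\<lambda>t. X t \<omega>) (extinction_time (\<lambda>t. X t \<omega>)))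
       \<partial>uniform_measure M {\<omega> \<in> space M. extinction_time (\<lambda>t. X t \<omega>) < \<infinity>})"


section \<open>Generating functions and recursions\<close>

definition B_gf :: "(nat \<Rightarrow> real) \<Rightarrow> real \<Rightarrow> real" where
  "B_gf b u = suminf (\<lambda>j. b j * u ^ j)"

definition B_bar :: "(nat \<Rightarrow> real) \<Rightarrow> nat set \<Rightarrow> real \<Rightarrow> real" where
  "B_bar b N u = suminf (\<lambda>j. if j \<in> N then 0 else b j * u ^ j)"

definition is_min_root :: "(real \<Rightarrow> real) \<Rightarrow> real \<Rightarrow> bool" where
  "is_min_root f u \<longleftrightarrow> u \<in> {0..1} \<and> f u = 0 \<and> (\<forall>u'\<in>{0..1}. f u' = 0 \<longrightarrow> u \<le> u')"

text \<open>Vectors of natural numbers indexed by \<open>N\<close>, as finitely supported functions.\<close>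

definition vecs :: "nat set \<Rightarrow> (nat \<Rightarrow>\<^sub>0 nat) set" where
  "vecs N = {l. Poly_Mapping.keys l \<subseteq> N}"

abbreviation unit_vec :: "nat \<Rightarrow> (nat \<Rightarrow>\<^sub>0 nat)" where
  "unit_vec k \<equiv> Poly_Mapping.single k 1"

definition total :: "(nat \<Rightarrow>\<^sub>0 nat) \<Rightarrow> nat" where
  "total l = (\<Sum>k\<in>Poly_Mapping.keys l. Poly_Mapping.lookup l k)"

definition vec_power :: "nat set \<Rightarrow> (nat \<Rightarrow> real) \<Rightarrow> (nat \<Rightarrow>\<^sub>0 nat) \<Rightarrow> real" where
  "vec_power N v l = (\<Prod>k\<in>N. v k ^ Poly_Mapping.lookup l k)"

text \<open>
  Ordered decompositions of \<open>l\<close> into \<open>j\<close> summands. If \<open>l\<close> is in \<open>vecs N\<close>, then so are all the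
  summands. For \<open>j = 0\<close> the only candidate is the empty list, whose sum is the zero vector.
\<close>

definition decompositions :: "nat \<Rightarrow> (nat \<Rightarrow>\<^sub>0 nat) \<Rightarrow> (nat \<Rightarrow>\<^sub>0 nat) list set" where
  "decompositions j l = {ls. length ls = j \<and> sum_list ls = l}"

definition conv_power :: "((nat \<Rightarrow>\<^sub>0 nat) \<Rightarrow> real) \<Rightarrow> nat \<Rightarrow> (nat \<Rightarrow>\<^sub>0 nat) \<Rightarrow> real" where
  "conv_power r j l = (\<Sum>ls\<in>decompositions j l. prod_list (map r ls))"

definition bounded_conv_power ::
    "((nat \<Rightarrow>\<^sub>0 nat) \<Rightarrow> real) \<Rightarrow> nat \<Rightarrow> nat \<Rightarrow> (nat \<Rightarrow>\<^sub>0 nat) \<Rightarrow> real" where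
  "bounded_conv_power r d j l =
     (\<Sum>ls\<in>{ls \<in> decompositions j l. \<forall>a\<in>set ls. total a \<le> d}. prod_list (map r ls))"

definition crossing_recursion ::
    "(nat \<Rightarrow> real) \<Rightarrow> nat set \<Rightarrow> ((nat \<Rightarrow>\<^sub>0 nat) \<Rightarrow> real) \<Rightarrow> bool" where
  "crossing_recursion b N r \<longleftrightarrow>
     is_min_root (B_bar b N) (r 0) \<and>
     (\<forall>l\<in>vecs N. \<forall>k\<in>N.
        r (l + unit_vec k) =
          - (suminf (\<lambda>j. if j \<in> N \<union> {1} then 0
                   else b j * bounded_conv_power r (total l) j (l + unit_vec k))
             + b k * conv_power r k l)
          / deriv (B_bar b N) (r 0))"

text \<open>
  If \<open>N\<close> has at least two elements and \<open>b 0 > 0\<close>, no family satisfies \<open>crossing_recursion\<close>: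
  a vector with several nonzero coordinates can be written as \<open>l + unit_vec k\<close> for different
  \<open>k\<close>, and the equations for these \<open>k\<close> contradict each other. The next recursion has the last
  term summed over all such \<open>k\<close>. This is the comparison of coefficients in
  \<open>B_bar b N \<phi> + (\<Sum>k\<in>N. b k * v k * \<phi> ^ k) = 0\<close> for the power series \<open>\<phi>\<close> in \<open>v\<close> with
  coefficients \<open>r\<close>. For \<open>N\<close> with at most one element both recursions are the same.
\<close>

definition crossing_recursion_summed ::
    "(nat \<Rightarrow> real) \<Rightarrow> nat set \<Rightarrow> ((nat \<Rightarrow>\<^sub>0 nat) \<Rightarrow> real) \<Rightarrow> bool" where
  "crossing_recursion_summed b N r \<longleftrightarrow>
     is_min_root (B_bar b N) (r 0) \<and>
     (\<forall>l\<in>vecs N. \<forall>k\<in>N.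
        r (l + unit_vec k) =
          - (suminf (\<lambda>j. if j \<in> N \<union> {1} then 0
                   else b j * bounded_conv_power r (total l) j (l + unit_vec k))
             + (\<Sum>m\<in>Poly_Mapping.keys (l + unit_vec k). b m * conv_power r m (l + unit_vec k - unit_vec m)))
          / deriv (B_bar b N) (r 0))"

end

theory Submission
  imports Defs
begin

text \<open>
  The weights only change the holding times: the jump chain is a random walk stopped at \<open>0\<close> with
  steps \<open>d - 1\<close> of probability \<open>b d / - b 1\<close>, and extinction and the crossing numbers depend
  only on this walk. Let \<open>hit i l\<close> be the probability that the walk hits \<open>0\<close> from \<open>i\<close> with
  step counts \<open>l\<close>. As the walk goes down by at most one, \<open>hit i\<close> is the \<open>i\<close>-th convolution power
  of \<open>hit 1\<close>, so that conditioning on the first step gives an equation for \<open>hit 1\<close>. Collecting in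
  it the terms with \<open>hit 1 l\<close>, whose total factor is the derivative of \<open>B_bar\<close>, turns it into the
  recursion, and minimality of the hitting probabilities identifies \<open>hit 1 0\<close> as the minimal root.
\<close>

section \<open>Step paths and their jumps\<close>

text \<open>The obstacle on the probabilistic side is that \<open>regular_ctmc\<close> gives only
  finite-dimensional distributions, neither holding times nor a jump chain. The law of the jump
  chain is therefore obtained as a limit of chains observed on ever finer grids: there the waiting
  is a geometric series, and \<open>(1 - p h i i) / h\<close> tends to \<open>- Q i i\<close>. What
  results is the probability of each finite word of states read from time 0. It has to replace the
  strong Markov property, so the comparison with \<open>hit\<close> carries a fixed prefix of steps
  along.

  The root \<open>\<rho>\<close> comes from the same theory with no marked step: the total mass of
  extinction is then the single coefficient \<open>hit 1 0\<close>, the minimal root of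
  \<open>B_gf b\<close>.

  The recursion with a single last term is reduced by cases. If \<open>b 0 = 0\<close>, extinction
  has probability 0, and the claimed equation reads 0 = 0 because \<open>inverse 0 = 0\<close>.
  Otherwise a solution forces \<open>N\<close> to have at most one element, and then both recursions
  coincide.\<close>

lemma right_continuous_nat:
  fixes x :: "real \<Rightarrow> nat"
  assumes "continuous (at_right t) x"
  shows "\<exists>e>0. \<forall>u\<in>{t..<t+e}. x u = x t"
proof -
  have "(x \<longlongrightarrow> x t) (at_right t)"
    using assms by (simp add: continuous_within)
  then have "eventually (\<lambda>u. x u \<in> {x t}) (at_right t)"
    by (simp add: tendsto_discrete)
  then obtain c where c: "c > t" "\<And>u. t < u \<Longrightarrow> u < c \<Longrightarrow> x u = x t"
    by (auto simp: eventually_at_right[of t "t + 1"])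
  show ?thesis
    by (rule exI[of _ "c - t"]) (use c in \<open>auto simp: order.order_iff_strict\<close>)
qed

text \<open>The time is the infimum of the later times with another value. If the old value were
  still taken there, right-continuity would keep it for a while and push the infimum up.\<close>

lemma first_change:
  fixes x :: "real \<Rightarrow> nat"
  assumes rc: "\<And>t. 0 \<le> t \<Longrightarrow> continuous (at_right t) x"
    and s: "0 \<le> s" "s \<le> u" "x u \<noteq> x s"
  shows "\<exists>t. s < t \<and> t \<le> u \<and> (\<forall>v\<in>{s..<t}. x v = x s) \<and> x t \<noteq> x s"
proof -
  define S where "S = {t. s \<le> t \<and> x t \<noteq> x s}"
  define t where "t = Inf S"
  have uS: "u \<in> S" using s by (auto simp: S_def)
  have bdd: "bdd_below S" by (auto simp: S_def bdd_below_def)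
  have tu: "t \<le> u" unfolding t_def by (rule cInf_lower[OF uS bdd])
  have below: "x v = x s" if "s \<le> v" "v < t" for v
  proof (rule ccontr)
    assume "x v \<noteq> x s"
    then have "v \<in> S" using that by (auto simp: S_def)
    then have "t \<le> v" unfolding t_def by (rule cInf_lower[OF _ bdd])
    then show False using that by simp
  qed
  have st: "s \<le> t" unfolding t_def using uS by (intro cInf_greatest) (auto simp: S_def)
  have ne: "x t \<noteq> x s"
  proof
    assume eq: "x t = x s"
    obtain e where e: "e > 0" "\<forall>u\<in>{t..<t+e}. x u = x t"
      using right_continuous_nat[OF rc, of t] order.trans[OF s(1) st] by blast
    have "t + e \<le> y" if "y \<in> S" for y
    proof (rule ccontr)
      assume "\<not> t + e \<le> y"
      moreover have "t \<le> y" unfolding t_def by (rule cInf_lower[OF that bdd])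
      ultimately have "x y = x s" using bspec[OF e(2), of y] eq by simp
      with that show False by (auto simp: S_def)
    qed
    then have "t + e \<le> t" unfolding t_def using uS by (intro cInf_greatest) auto
    with e show False by simp
  qed
  then have "s < t" using st ne by (metis order.order_iff_strict)
  moreover have "\<forall>v\<in>{s..<t}. x v = x s"
    by (intro ballI below) simp_all
  ultimately show ?thesis using tu ne by blast
qed

text \<open>\<open>jump_path x s ws T\<close>: the states visited after time \<open>s\<close> up to a jump at time \<open>T\<close> are \<open>ws\<close>.\<close>

fun jump_path :: "(real \<Rightarrow> nat) \<Rightarrow> real \<Rightarrow> nat list \<Rightarrow> real \<Rightarrow> bool" where
  "jump_path x s [] T \<longleftrightarrow> T = s"
| "jump_path x s (j # ws) T \<longleftrightarrow>
     (\<exists>t>s. (\<forall>u\<in>{s..<t}. x u = x s) \<and> x t = j \<and> j \<noteq> x s \<and> jump_path x t ws T)"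

declare jump_path.simps(2) [simp del]

lemma jump_path_ConsI:
  "s < t \<Longrightarrow> \<forall>u\<in>{s..<t}. x u = x s \<Longrightarrow> x t = j \<Longrightarrow> j \<noteq> x s \<Longrightarrow>
    jump_path x t ws T \<Longrightarrow> jump_path x s (j # ws) T"
  unfolding jump_path.simps(2) by blast

lemma jump_path_ConsE:
  assumes "jump_path x s (j # ws) T"
  obtains t where "s < t" "\<forall>u\<in>{s..<t}. x u = x s" "x t = j" "j \<noteq> x s"
    "jump_path x t ws T"
  using assms unfolding jump_path.simps(2) by blast

lemma jump_path_induct [consumes 1, case_names Nil Cons]:
  assumes "jump_path x s ws T"
    and "\<And>s. P s [] s"
    and "\<And>s t j ws T. s < t \<Longrightarrow> \<forall>u\<in>{s..<t}. x u = x s \<Longrightarrow> x t = j \<Longrightarrow> j \<noteq> x s \<Longrightarrow>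
      jump_path x t ws T \<Longrightarrow> P t ws T \<Longrightarrow> P s (j # ws) T"
  shows "P s ws T"
  using assms(1)
proof (induction ws arbitrary: s)
  case Nil
  then show ?case using assms(2) by simp
next
  case (Cons j ws)
  from Cons.prems obtain t where t: "s < t" "\<forall>u\<in>{s..<t}. x u = x s" "x t = j" "j \<noteq> x s"
    "jump_path x t ws T"
    by (rule jump_path_ConsE)
  then show ?case using assms(3)[OF t] Cons.IH by blast
qed

lemma jump_path_ge: "jump_path x s ws T \<Longrightarrow> s \<le> T"
proof (induction rule: jump_path_induct)
  case (Cons s t j ws T)
  then show ?case by linarith
qed simp

lemma jump_path_last: "jump_path x s ws T \<Longrightarrow> x T = last (x s # ws)"
proof (induction rule: jump_path_induct)
  case (Cons s t j ws T)
  from Cons.hyps(3) Cons.IH show ?case by simp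
qed simp

lemma first_change_unique:
  fixes t t' :: real
  assumes "s < t" "\<forall>u\<in>{s..<t}. x u = x s" "x t \<noteq> x s"
    and "s < t'" "\<forall>u\<in>{s..<t'}. x u = x s" "x t' \<noteq> x s"
  shows "t = t'"
proof (cases t t' rule: linorder_cases)
  case less
  then have "t \<in> {s..<t'}" using assms(1) by simp
  then show ?thesis using assms(3,5) by blast
next
  case greater
  then have "t' \<in> {s..<t}" using assms(4) by simp
  then show ?thesis using assms(2,6) by blast
qed

lemma jump_path_append:
  "jump_path x s (us @ ws) T \<Longrightarrow> \<exists>t. jump_path x s us t \<and> jump_path x t ws T"
proof (induction us arbitrary: s)
  case Nil
  then show ?case by auto
next
  case (Cons j us)
  from Cons.prems obtain t where t: "s < t" "\<forall>u\<in>{s..<t}. x u = x s" "x t = j" "j \<noteq> x s"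
    "jump_path x t (us @ ws) T"
    unfolding append_Cons by (rule jump_path_ConsE)
  then show ?case using Cons.IH[of t] jump_path_ConsI[OF t(1-4)] by blast
qed

lemma jump_path_unique:
  assumes "jump_path x s us T" "jump_path x s ws T'" "length us = length ws"
  shows "us = ws \<and> T = T'"
  using assms
proof (induction arbitrary: ws rule: jump_path_induct)
  case (Nil s)
  then show ?case by auto
next
  case (Cons s t j us T)
  from Cons.prems obtain j' ws' where ws: "ws = j' # ws'" by (cases ws) auto
  with Cons.prems obtain t' where t': "s < t'" "\<forall>u\<in>{s..<t'}. x u = x s" "x t' = j'"
    "j' \<noteq> x s" "jump_path x t' ws' T'"
    by (blast elim: jump_path_ConsE)
  have "t = t'"
    using first_change_unique[OF Cons.hyps(1,2) _ t'(1,2)] Cons.hyps(3,4) t'(3,4) by metis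
  then show ?case using Cons.IH[of ws'] Cons.hyps(3) Cons.prems(2) t'(3,5) ws by simp
qed

text \<open>A path determines its jumps one after the other. This later makes the events of
  different next steps disjoint.\<close>

lemma jump_path_unique_head:
  assumes "jump_path x s (us @ j # ws) T" "jump_path x s (us @ j' # ws') T'"
  shows "j = j'"
proof -
  obtain t where "jump_path x s (us @ [j]) t"
    using jump_path_append[of x s "us @ [j]" ws T] assms by auto
  moreover obtain t' where "jump_path x s (us @ [j']) t'"
    using jump_path_append[of x s "us @ [j']" ws' T'] assms by auto
  ultimately show ?thesis using jump_path_unique by fastforce
qed

text \<open>The counterpart of \<open>jump_path\<close> for a chain in discrete time: equal
  consecutive values count as waiting, and \<open>a\<close> is the number of repetitions before the
  change.\<close>

fun skeleton_path :: "(nat \<Rightarrow> nat) \<Rightarrow> nat list \<Rightarrow> bool" where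
  "skeleton_path y [] \<longleftrightarrow> True"
| "skeleton_path y (j # ws) \<longleftrightarrow>
     (\<exists>a. (\<forall>m\<le>a. y m = y 0) \<and> y (Suc a) = j \<and> j \<noteq> y 0 \<and> skeleton_path (\<lambda>m. y (Suc a + m)) ws)"

text \<open>The offset \<open>s'\<close> is free in \<open>{s..<s + h}\<close> because after a jump
  the observations resume at the first grid point at or after it, in general not at the jump time.
  The bound on \<open>h\<close> is the minimum of the bound for the remaining word and of the
  waiting time \<open>t - s\<close>, so that a grid point falls into the waiting interval.\<close>

lemma skeleton_path_iff:
  fixes x :: "real \<Rightarrow> nat"
  assumes rc: "\<And>t. 0 \<le> t \<Longrightarrow> continuous (at_right t) x" and "0 \<le> s"
  shows "\<exists>\<delta>>0. \<forall>h s'. 0 < h \<and> h < \<delta> \<and> s \<le> s' \<and> s' < s + h \<longrightarrow>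
    x s' = x s \<and> (skeleton_path (\<lambda>m. x (s' + real m * h)) ws \<longleftrightarrow> (\<exists>T. jump_path x s ws T))"
  using \<open>0 \<le> s\<close>
proof (induction ws arbitrary: s)
  case Nil
  obtain e where "e > 0" "\<forall>u\<in>{s..<s+e}. x u = x s"
    using right_continuous_nat[OF rc] Nil by blast
  moreover have "s' \<in> {s..<s+e}" if "0 < h \<and> h < e \<and> s \<le> s' \<and> s' < s + h" for h s'
    using that by auto
  ultimately have "\<forall>h s'. 0 < h \<and> h < e \<and> s \<le> s' \<and> s' < s + h \<longrightarrow> x s' = x s"
    by metis
  with \<open>e > 0\<close> show ?case
    by (intro exI[of _ e]) simp
next
  case (Cons j ws)
  obtain e where e: "e > 0" "\<forall>u\<in>{s..<s+e}. x u = x s"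
    using right_continuous_nat[OF rc] Cons.prems by blast
  show ?case
  proof (cases "\<exists>u\<ge>s. x u \<noteq> x s")
    case False
    then have const: "x u = x s" if "s \<le> u" for u using that by blast
    show ?thesis
    proof (intro exI[of _ e] conjI allI impI)
      fix h s' assume a: "0 < h \<and> h < e \<and> s \<le> s' \<and> s' < s + h"
      have *: "x (s' + real m * h) = x s" for m
        by (rule const) (use a in \<open>auto simp: add_increasing2\<close>)
      show "x s' = x s" using *[of 0] by simp
      show "skeleton_path (\<lambda>m. x (s' + real m * h)) (j # ws) \<longleftrightarrow> (\<exists>T. jump_path x s (j # ws) T)"
      proof -
        have "\<not> jump_path x s (j # ws) T" for T
        proof
          assume "jump_path x s (j # ws) T"
          then obtain t where "s < t" "x t = j" "j \<noteq> x s" by (rule jump_path_ConsE)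
          then show False using const[of t] by simp
        qed
        moreover have "\<not> skeleton_path (\<lambda>m. x (s' + real m * h)) (j # ws)"
          unfolding skeleton_path.simps * by blast
        ultimately show ?thesis by blast
      qed
    qed (use e in auto)
  next
    case True
    then obtain t where t: "s < t" "\<forall>v\<in>{s..<t}. x v = x s" "x t \<noteq> x s"
      using first_change[OF rc Cons.prems] by (metis)
    obtain \<delta> where \<delta>: "\<delta> > 0" "\<And>h s'. 0 < h \<and> h < \<delta> \<and> t \<le> s' \<and> s' < t + h \<Longrightarrow>
       x s' = x t \<and> (skeleton_path (\<lambda>m. x (s' + real m * h)) ws \<longleftrightarrow> (\<exists>T. jump_path x t ws T))"
      using Cons.IH[of t] Cons.prems t(1) by (auto simp del: skeleton_path.simps)
    show ?thesis
    proof (intro exI[of _ "min \<delta> (t - s)"] conjI allI impI)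
      show "0 < min \<delta> (t - s)" using \<delta>(1) t(1) by simp
      fix h s' assume a: "0 < h \<and> h < min \<delta> (t - s) \<and> s \<le> s' \<and> s' < s + h"
      then have s't: "s' < t" by auto
      show xs': "x s' = x s" by (rule bspec[OF t(2)]) (use a s't in simp)
      \<comment> \<open>\<open>a'\<close> is the index of the first grid point at or after the jump
        time \<open>t\<close>. It is positive since \<open>s' < t\<close>, and its predecessor
        \<open>a0\<close> is the index of the last grid point before the jump.\<close>
      define a' where "a' = nat \<lceil>(t - s') / h\<rceil>"
      have pos: "(t - s') / h > 0" using a s't by auto
      have a'1: "real a' \<ge> (t - s') / h" and a'2: "real a' < (t - s') / h + 1" "a' > 0"
        using pos unfolding a'_def by linarith+
      obtain a0 where a0: "a' = Suc a0" using a'2 by (cases a') auto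
      have t1: "t \<le> s' + real (Suc a0) * h"
        using a'1 a a0 by (simp add: field_simps)
      have t2: "s' + real (Suc a0) * h < t + h"
        using a'2 a a0 by (simp add: field_simps)
      have before: "x (s' + real m * h) = x s" if "m \<le> a0" for m
      proof (rule bspec[OF t(2)])
        have "real m * h \<le> real a0 * h" using that a by (intro mult_right_mono) auto
        moreover have "s' + real a0 * h < t" using t2 by (simp add: algebra_simps)
        ultimately have "s' + real m * h < t" by linarith
        then show "s' + real m * h \<in> {s..<t}" using a by (auto simp: add_increasing2)
      qed
      have after: "x (s' + real (Suc a0) * h) = x t"
        and IH: "skeleton_path (\<lambda>m. x ((s' + real (Suc a0) * h) + real m * h)) ws \<longleftrightarrow> (\<exists>T. jump_path x t ws T)"
        using \<delta>(2)[of h "s' + real (Suc a0) * h"] a t1 t2 by auto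
      have shift: "s' + real (Suc a0 + m) * h = (s' + real (Suc a0) * h) + real m * h" for m
        by (simp add: algebra_simps)
      have "skeleton_path (\<lambda>m. x (s' + real m * h)) (j # ws) \<longleftrightarrow>
        x t = j \<and> skeleton_path (\<lambda>m. x (s' + real (Suc a0 + m) * h)) ws"
      proof
        assume "skeleton_path (\<lambda>m. x (s' + real m * h)) (j # ws)"
        then obtain a1 where a1: "\<And>m. m \<le> a1 \<Longrightarrow> x (s' + real m * h) = x s'"
          "x (s' + real (Suc a1) * h) = j" "j \<noteq> x s'"
          "skeleton_path (\<lambda>m. x (s' + real (Suc a1 + m) * h)) ws"
          by auto
        have "a1 < Suc a0"
        proof (rule ccontr)
          assume "\<not> a1 < Suc a0"
          then have "x (s' + real (Suc a0) * h) = x s'" using a1(1)[of "Suc a0"] by linarith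
          then show False using after t(3) xs' by simp
        qed
        moreover have "\<not> a1 < a0"
          using before[of "Suc a1"] a1 xs' by auto
        ultimately have "a1 = a0" by simp
        then show "x t = j \<and> skeleton_path (\<lambda>m. x (s' + real (Suc a0 + m) * h)) ws"
          using a1 after by auto
      next
        assume "x t = j \<and> skeleton_path (\<lambda>m. x (s' + real (Suc a0 + m) * h)) ws"
        then show "skeleton_path (\<lambda>m. x (s' + real m * h)) (j # ws)"
          using before after t(3) xs' by (auto intro!: exI[of _ a0])
      qed
      also have "\<dots> \<longleftrightarrow> x t = j \<and> (\<exists>T. jump_path x t ws T)"
        unfolding shift IH ..
      also have "\<dots> \<longleftrightarrow> (\<exists>T. jump_path x s (j # ws) T)"
      proof
        assume "x t = j \<and> (\<exists>T. jump_path x t ws T)"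
        then show "\<exists>T. jump_path x s (j # ws) T" using jump_path_ConsI[OF t(1,2)] t(3) by blast
      next
        assume "\<exists>T. jump_path x s (j # ws) T"
        then obtain t' T where t': "s < t'" "\<forall>u\<in>{s..<t'}. x u = x s" "x t' = j"
          "j \<noteq> x s" "jump_path x t' ws T"
          by (blast elim: jump_path_ConsE)
        have "t = t'"
          using first_change_unique[OF t t'(1,2)] t'(3,4) by metis
        then show "x t = j \<and> (\<exists>T. jump_path x t ws T)" using t'(3,5) by blast
      qed
      finally show "skeleton_path (\<lambda>m. x (s' + real m * h)) (j # ws) \<longleftrightarrow> (\<exists>T. jump_path x s (j # ws) T)" .
    qed
  qed
qed

lemma jump_path_iff_eventually_skeleton:
  fixes x :: "real \<Rightarrow> nat"
  assumes rc: "\<And>t. 0 \<le> t \<Longrightarrow> continuous (at_right t) x"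
  shows "\<forall>\<^sub>F h in at_right 0. skeleton_path (\<lambda>m. x (real m * h)) ws \<longleftrightarrow> (\<exists>T. jump_path x 0 ws T)"
proof -
  obtain \<delta> where \<delta>: "\<delta> > 0" "\<And>h s'. 0 < h \<and> h < \<delta> \<and> 0 \<le> s' \<and> s' < 0 + h \<Longrightarrow>
       x s' = x 0 \<and> (skeleton_path (\<lambda>m. x (s' + real m * h)) ws \<longleftrightarrow> (\<exists>T. jump_path x 0 ws T))"
    using skeleton_path_iff[OF rc, of 0 ws] by auto
  show ?thesis
    unfolding eventually_at_right[OF zero_less_one]
    by (rule exI[of _ \<delta>]) (use \<delta>(1) \<delta>(2)[of _ 0] in auto)
qed

section \<open>Jump times and crossings read off from a jump path\<close>

lemma jump_times_constant:
  fixes x :: "real \<Rightarrow> nat"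
  assumes "\<forall>u\<in>{s..<t}. x u = i" "u \<in> {s<..<t}"
  shows "u \<notin> jump_times x"
proof -
  have "eventually (\<lambda>v. v \<in> {s<..<t}) (nhds u)"
    using assms(2) by (intro eventually_nhds_in_open) auto
  then have "eventually (\<lambda>v. x v = i) (nhds u)"
    by eventually_elim (use assms(1) in auto)
  then have "isCont x u \<longleftrightarrow> isCont (\<lambda>_. i) u" by (rule isCont_cong)
  then show ?thesis by (auto simp: jump_times_def)
qed

lemma left_limit:
  fixes x :: "real \<Rightarrow> nat"
  assumes "\<forall>u\<in>{s..<t}. x u = i" "s < t"
  shows "(x \<longlongrightarrow> j) (at_left t) \<longleftrightarrow> j = i"
proof -
  have "eventually (\<lambda>v. x v = i) (at_left t)"
    using assms by (auto simp: eventually_at_left[OF assms(2)] intro!: exI[of _ s])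
  then have *: "(x \<longlongrightarrow> j) (at_left t) \<longleftrightarrow> ((\<lambda>_. i) \<longlongrightarrow> j) (at_left t)" for j
    by (rule tendsto_cong)
  have "(x \<longlongrightarrow> i) (at_left t)" unfolding * by simp
  then show ?thesis using tendsto_unique[of "at_left t" x i j] by auto
qed

lemma jump_times_change:
  fixes x :: "real \<Rightarrow> nat"
  assumes "\<forall>u\<in>{s..<t}. x u = i" "s < t" "0 \<le> s" "x t \<noteq> i"
  shows "t \<in> jump_times x"
proof -
  have "\<not> isCont x t"
  proof
    assume "isCont x t"
    then have "(x \<longlongrightarrow> x t) (at t)" by (simp add: isCont_def)
    then have "(x \<longlongrightarrow> x t) (at_left t)" by (rule filterlim_mono) (auto simp: at_le)
    then show False using left_limit[OF assms(1,2)] assms(4) by simp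
  qed
  then show ?thesis using assms by (auto simp: jump_times_def)
qed

text \<open>Every first change is a discontinuity, so passing to it removes a point from the finite
  set of jump times in \<open>{s<..T}\<close>. This is where non-explosion enters.\<close>

lemma exists_jump_path:
  fixes x :: "real \<Rightarrow> nat"
  assumes rc: "\<And>t. 0 \<le> t \<Longrightarrow> continuous (at_right t) x"
    and fin: "finite (jump_times x \<inter> {..T})" and "0 \<le> s" "s \<le> T"
  shows "\<exists>ws T'. jump_path x s ws T' \<and> T' \<le> T \<and> (\<forall>u\<in>{T'..T}. x u = x T')"
  using assms(3,4)
proof (induction "card (jump_times x \<inter> {s<..T})" arbitrary: s rule: less_induct)
  case less
  show ?case
  proof (cases "\<exists>u\<in>{s..T}. x u \<noteq> x s")
    case False
    then have "jump_path x s [] s \<and> s \<le> T \<and> (\<forall>u\<in>{s..T}. x u = x s)"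
      using less.prems jump_path.simps(1) by blast
    then show ?thesis by blast
  next
    case True
    then obtain t where t: "s < t" "t \<le> T" "\<forall>v\<in>{s..<t}. x v = x s" "x t \<noteq> x s"
      using first_change[OF rc less.prems(1)] by (metis atLeastAtMost_iff order.trans)
    have "t \<in> jump_times x" by (rule jump_times_change[where i = "x s", OF t(3,1) less.prems(1) t(4)])
    then have "jump_times x \<inter> {t<..T} \<subset> jump_times x \<inter> {s<..T}" using t(1,2) by auto
    moreover have "finite (jump_times x \<inter> {s<..T})" by (rule finite_subset[OF _ fin]) auto
    ultimately have "card (jump_times x \<inter> {t<..T}) < card (jump_times x \<inter> {s<..T})"
      by (rule psubset_card_mono[rotated])
    from less.hyps[OF this] less.prems t(1,2) obtain ws T' where
      "jump_path x t ws T'" "T' \<le> T" "\<forall>u\<in>{T'..T}. x u = x T'"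
      by auto
    then show ?thesis using jump_path_ConsI[OF t(1,3) refl t(4)] by blast
  qed
qed

definition crossing_times :: "nat \<Rightarrow> (real \<Rightarrow> nat) \<Rightarrow> real set" where
  "crossing_times k x = {s \<in> jump_times x. \<exists>i\<ge>1. (x \<longlongrightarrow> i) (at_left s) \<and> x s = i + k - 1}"

lemma crossing_number_eq:
  "crossing_number k x T = card {s \<in> crossing_times k x. ereal s \<le> T}"
  unfolding crossing_number_def crossing_times_def by (rule arg_cong[where f = card]) auto

fun crossing_count :: "nat \<Rightarrow> nat \<Rightarrow> nat list \<Rightarrow> nat" where
  "crossing_count k i [] = 0"
| "crossing_count k i (j # ws) = (if 1 \<le> i \<and> j = i + k - 1 then 1 else 0) + crossing_count k j ws"

text \<open>Inside an interval of constancy there are no jumps, and at its end the left limit is the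
  constant value. Each letter of the word thus contributes exactly one possible crossing.\<close>

lemma jump_path_crossing_count:
  assumes "jump_path x s ws T" "0 \<le> s"
  shows "finite (crossing_times k x \<inter> {s<..T})
    \<and> card (crossing_times k x \<inter> {s<..T}) = crossing_count k (x s) ws"
  using assms
proof (induction rule: jump_path_induct)
  case (Nil s)
  then show ?case by simp
next
  case (Cons s t j ws T)
  have tT: "t \<le> T" using jump_path_ge[OF Cons.hyps(5)] .
  have "u \<notin> crossing_times k x" if "u \<in> {s<..<t}" for u
    using jump_times_constant[where i = "x s", OF Cons.hyps(2) that] by (simp add: crossing_times_def)
  then have eq: "crossing_times k x \<inter> {s<..T} = (crossing_times k x \<inter> {t}) \<union> (crossing_times k x \<inter> {t<..T})"
    using tT Cons.hyps(1) by force
  have "x t \<noteq> x s" using Cons.hyps(3,4) by simp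
  then have "t \<in> jump_times x"
    by (rule jump_times_change[where i = "x s", OF Cons.hyps(2,1) Cons.prems])
  then have "t \<in> crossing_times k x \<longleftrightarrow> 1 \<le> x s \<and> j = x s + k - 1"
    using left_limit[where i = "x s", OF Cons.hyps(2,1)] Cons.hyps(3) by (auto simp: crossing_times_def)
  then have "crossing_times k x \<inter> {t} = (if 1 \<le> x s \<and> j = x s + k - 1 then {t} else {})"
    by auto
  then show ?case
    using Cons.IH Cons.prems Cons.hyps(1,3) unfolding eq
    by (subst card_Un_disjoint) auto
qed

section \<open>The law of the jump chain\<close>

text \<open>The condition \<open>A\<close> concerns the states that are left, not the last one: the
  absorbing state 0 may end a word although it has no exit rate.\<close>

fun leaving :: "(nat \<Rightarrow> bool) \<Rightarrow> nat \<Rightarrow> nat list \<Rightarrow> bool" where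
  "leaving A i [] \<longleftrightarrow> True"
| "leaving A i (j # ws) \<longleftrightarrow> A i \<and> j \<noteq> i \<and> leaving A j ws"

text \<open>For \<open>P i i < 1\<close> the factor \<open>P i j / (1 - P i i)\<close> is the sum of
  \<open>P i i ^ a * P i j\<close> over all waiting times \<open>a\<close>, the law of the next
  different state.\<close>

fun skeleton_prob :: "(nat \<Rightarrow> nat \<Rightarrow> real) \<Rightarrow> nat \<Rightarrow> nat list \<Rightarrow> real" where
  "skeleton_prob P i [] = 1"
| "skeleton_prob P i (j # ws) = P i j / (1 - P i i) * skeleton_prob P j ws"

fun embedded_prob :: "(nat \<Rightarrow> nat \<Rightarrow> real) \<Rightarrow> nat \<Rightarrow> nat list \<Rightarrow> real" where
  "embedded_prob Q i [] = 1"
| "embedded_prob Q i (j # ws) = Q i j / - Q i i * embedded_prob Q j ws"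

lemma measurable_skeleton_path:
  assumes "\<And>n. Z n \<in> M \<rightarrow>\<^sub>M count_space UNIV"
  shows "Measurable.pred M (\<lambda>\<omega>. skeleton_path (\<lambda>m. Z m \<omega>) ws)"
  using assms
proof (induction ws arbitrary: Z)
  case (Cons j ws)
  have "Measurable.pred M (\<lambda>\<omega>. skeleton_path (\<lambda>m. Z (Suc a + m) \<omega>) ws)" for a
    by (rule Cons.IH) (rule Cons.prems)
  moreover have eq: "Measurable.pred M (\<lambda>\<omega>. Z m \<omega> = k)" for m k
    using measurable_compose[OF Cons.prems[of m], of "\<lambda>n. n = k" "count_space UNIV"] by simp
  moreover have "Measurable.pred M (\<lambda>\<omega>. \<exists>k. Z m \<omega> = k \<and> Z 0 \<omega> = k)" for m
    by (intro pred_intros_countable pred_intros_logic eq)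
  moreover have "Measurable.pred M (\<lambda>\<omega>. \<not> Z 0 \<omega> = j)"
    by (intro pred_intros_logic eq)
  ultimately show ?case
    unfolding skeleton_path.simps
    by (intro pred_intros_countable pred_intros_logic pred_intros_countable_bounded)
      (simp_all add: eq_commute)
qed simp

context prob_space
begin

text \<open>The prescribed prefix \<open>z\<close> up to time \<open>n\<close> stands in for a
  conditional Markov property: the induction hypothesis is applied to the prefix prolonged by the
  waiting and the jump. Summing over the waiting time gives a geometric series.\<close>

lemma skeleton_path_prob:
  fixes Z :: "nat \<Rightarrow> 'a \<Rightarrow> nat"
  assumes meas [measurable]: "\<And>n. Z n \<in> M \<rightarrow>\<^sub>M count_space UNIV"
    and markov: "\<And>n i. prob {\<omega> \<in> space M. \<forall>m\<le>n. Z m \<omega> = i m} =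
      prob {\<omega> \<in> space M. Z 0 \<omega> = i 0} * (\<Prod>m<n. P (i m) (i (Suc m)))"
    and nonneg: "\<And>i. 0 \<le> P i i"
    and "leaving (\<lambda>i. P i i < 1) (z n) ws"
  shows "prob {\<omega> \<in> space M. (\<forall>m\<le>n. Z m \<omega> = z m) \<and> skeleton_path (\<lambda>m. Z (n + m) \<omega>) ws} =
    prob {\<omega> \<in> space M. \<forall>m\<le>n. Z m \<omega> = z m} * skeleton_prob P (z n) ws"
  using assms(4)
proof (induction ws arbitrary: z n)
  case (Cons j ws)
  define C where "C z n = {\<omega> \<in> space M. \<forall>m\<le>n. Z m \<omega> = z m}" for z n
  have C_Suc: "prob (C z (Suc n)) = prob (C z n) * P (z n) (z (Suc n))" for z n
    unfolding C_def markov by simp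
  have C_cong: "C z n = C z' n" if "\<And>m. m \<le> n \<Longrightarrow> z m = z' m" for z z' n
    using that by (auto simp: C_def)
  define i where "i = z n"
  have ij: "j \<noteq> i" "P i i < 1" "leaving (\<lambda>i. P i i < 1) j ws" using Cons.prems by (auto simp: i_def)
  \<comment> \<open>\<open>zc\<close> prolongs the prefix by waiting in \<open>i\<close> forever,
    \<open>za a\<close> by \<open>a\<close> further observations of \<open>i\<close> and then
    \<open>j\<close>. The event \<open>E a\<close> below says that the waiting lasts exactly that
    long.\<close>
  define zc where "zc m = (if m \<le> n then z m else i)" for m
  define za where "za a m = (if m \<le> n + a then zc m else j)" for a m
  have stay: "prob (C zc (n + a)) = prob (C z n) * P i i ^ a" for a
  proof (induction a)
    case 0
    have "C zc n = C z n" by (rule C_cong) (simp add: zc_def)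
    then show ?case by simp
  next
    case (Suc a)
    have "zc (n + a) = i" "zc (Suc (n + a)) = i" by (auto simp: zc_def i_def)
    then show ?case using Suc C_Suc[of zc "n + a"] by simp
  qed
  have za_end: "za a (n + a) = i" "za a (Suc (n + a)) = j" for a by (auto simp: za_def zc_def i_def)
  have exit: "prob (C (za a) (Suc (n + a))) = prob (C z n) * P i i ^ a * P i j" for a
  proof -
    have "C (za a) (n + a) = C zc (n + a)" by (rule C_cong) (simp add: za_def)
    then show ?thesis using C_Suc[of "za a" "n + a"] stay za_end by simp
  qed
  define E where "E a = {\<omega> \<in> space M. (\<forall>m\<le>Suc (n + a). Z m \<omega> = za a m) \<and>
      skeleton_path (\<lambda>m. Z (Suc (n + a) + m) \<omega>) ws}" for a
  have E_iff: "\<omega> \<in> E a \<longleftrightarrow> \<omega> \<in> space M \<and> (\<forall>m\<le>n. Z m \<omega> = z m) \<and> (\<forall>m\<le>a. Z (n + m) \<omega> = i) \<and>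
      Z (Suc (n + a)) \<omega> = j \<and> skeleton_path (\<lambda>m. Z (Suc (n + a) + m) \<omega>) ws" for \<omega> a
  proof -
    have "(\<forall>m\<le>Suc (n + a). Z m \<omega> = za a m) \<longleftrightarrow>
      (\<forall>m\<le>n. Z m \<omega> = z m) \<and> (\<forall>m\<le>a. Z (n + m) \<omega> = i) \<and> Z (Suc (n + a)) \<omega> = j" (is "?L \<longleftrightarrow> ?R")
    proof
      assume L: ?L
      have "Z (n + m) \<omega> = i" if "m \<le> a" for m
        using L[rule_format, of "n + m"] that by (cases m) (auto simp: za_def zc_def i_def)
      then show ?R using L za_end by (auto simp: za_def zc_def)
    next
      assume R: ?R
      show ?L
      proof (intro allI impI)
        fix m assume "m \<le> Suc (n + a)"
        then consider "m \<le> n" | "n < m" "m \<le> n + a" | "m = Suc (n + a)" by linarith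
        then show "Z m \<omega> = za a m"
        proof cases
          case 2
          then have "Z (n + (m - n)) \<omega> = i" using R by (metis add_le_cancel_left le_add_diff_inverse less_imp_le)
          then show ?thesis using 2 by (simp add: za_def zc_def)
        qed (use R za_end in \<open>auto simp: za_def zc_def\<close>)
      qed
    qed
    then show ?thesis by (auto simp: E_def)
  qed
  have E_sets: "range E \<subseteq> sets M"
  proof clarify
    fix a
    have [measurable]: "Measurable.pred M (\<lambda>\<omega>. skeleton_path (\<lambda>m. Z (Suc (n + a) + m) \<omega>) ws)"
      by (rule measurable_skeleton_path) (rule meas)
    show "E a \<in> events" unfolding E_def by measurable
  qed
  have disj: "disjoint_family E"
  proof -
    have False if "\<omega> \<in> E a" "\<omega> \<in> E a'" "a < a'" for \<omega> a a'
    proof -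
      have "Z (n + Suc a) \<omega> = i" using that E_iff[of \<omega> a'] by (metis Suc_leI)
      moreover have "Z (Suc (n + a)) \<omega> = j" using that E_iff by blast
      ultimately show False using ij by simp
    qed
    then show ?thesis unfolding disjoint_family_on_def by (metis disjoint_iff linorder_neqE_nat)
  qed
  have union: "{\<omega> \<in> space M. (\<forall>m\<le>n. Z m \<omega> = z m) \<and> skeleton_path (\<lambda>m. Z (n + m) \<omega>) (j # ws)} = (\<Union>a. E a)"
  proof (intro set_eqI)
    fix \<omega>
    show "\<omega> \<in> {\<omega> \<in> space M. (\<forall>m\<le>n. Z m \<omega> = z m) \<and> skeleton_path (\<lambda>m. Z (n + m) \<omega>) (j # ws)} \<longleftrightarrow> \<omega> \<in> (\<Union>a. E a)"
            proof (cases "\<forall>m\<le>n. Z m \<omega> = z m")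
        case True
        then have "Z n \<omega> = i" by (simp add: i_def)
        then show ?thesis using True ij(1) by (auto simp: E_iff add.assoc)
      qed (auto simp: E_iff)
  qed
  have prob_E: "prob (E a) = P i i ^ a * (prob (C z n) * P i j * skeleton_prob P j ws)" for a
    using Cons.IH[of "za a" "Suc (n + a)"] ij exit[of a] za_end
    by (simp add: E_def C_def mult_ac)
  have "(\<lambda>a. P i i ^ a * (prob (C z n) * P i j * skeleton_prob P j ws)) sums
    (1 / (1 - P i i) * (prob (C z n) * P i j * skeleton_prob P j ws))"
    by (intro sums_mult2 geometric_sums) (use ij nonneg in simp)
  moreover have "(\<lambda>a. prob (E a)) sums prob (\<Union>a. E a)"
    by (rule finite_measure_UNION[OF E_sets disj])
  ultimately have "prob (\<Union>a. E a) = 1 / (1 - P i i) * (prob (C z n) * P i j * skeleton_prob P j ws)"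
    unfolding prob_E using sums_unique2 by blast
  then show ?case unfolding union by (simp add: C_def i_def)
qed simp

end

section \<open>From finer and finer grids to continuous time\<close>

context regular_ctmc
begin

definition word_event :: "nat \<Rightarrow> nat list \<Rightarrow> 'a set" where
  "word_event i ws = {\<omega> \<in> space M. X 0 \<omega> = i \<and> (\<exists>T. jump_path (\<lambda>t. X t \<omega>) 0 ws T)}"

text \<open>A sequence of meshes keeps the limit countable, for the sake of measurability and of
  dominated convergence.\<close>

definition mesh :: "nat \<Rightarrow> real" where
  "mesh n = inverse (real (Suc n))"

definition skeleton_event :: "nat \<Rightarrow> nat list \<Rightarrow> nat \<Rightarrow> 'a set" where
  "skeleton_event i ws n =
     {\<omega> \<in> space M. X 0 \<omega> = i \<and> skeleton_path (\<lambda>m. X (real m * mesh n) \<omega>) ws}"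

lemma mesh_pos: "0 < mesh n"
  by (simp add: mesh_def)

lemma filterlim_mesh: "filterlim mesh (at_right 0) sequentially"
proof -
  have "mesh \<longlonglongrightarrow> 0" unfolding mesh_def by (rule LIMSEQ_inverse_real_of_nat)
  then show ?thesis
    by (rule tendsto_imp_filterlim_at_right) (simp add: mesh_pos)
qed

lemma skeleton_event_sets [measurable]: "skeleton_event i ws n \<in> events"
proof -
  have [measurable]: "(\<lambda>\<omega>. X (real m * mesh n) \<omega>) \<in> M \<rightarrow>\<^sub>M count_space UNIV" for m
    by (rule measurable_X) (use mesh_pos[of n] in simp)
  have [measurable]: "X 0 \<in> M \<rightarrow>\<^sub>M count_space UNIV" by (rule measurable_X) simp
  have [measurable]: "Measurable.pred M (\<lambda>\<omega>. skeleton_path (\<lambda>m. X (real m * mesh n) \<omega>) ws)"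
    by (rule measurable_skeleton_path) measurable
  show ?thesis unfolding skeleton_event_def by measurable
qed

lemma skeleton_event_eventually:
  assumes "\<omega> \<in> space M"
  shows "\<forall>\<^sub>F n in sequentially. \<omega> \<in> skeleton_event i ws n \<longleftrightarrow> \<omega> \<in> word_event i ws"
proof -
  have "\<forall>\<^sub>F h in at_right 0. skeleton_path (\<lambda>m. X (real m * h) \<omega>) ws \<longleftrightarrow> (\<exists>T. jump_path (\<lambda>t. X t \<omega>) 0 ws T)"
    by (rule jump_path_iff_eventually_skeleton) (rule right_continuous[OF assms])
  from eventually_compose_filterlim[OF this filterlim_mesh] show ?thesis
    by eventually_elim (use assms in \<open>auto simp: skeleton_event_def word_event_def\<close>)
qed

text \<open>The event is the limit inferior of the skeleton events. Read literally, its definition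
  is an uncountable union over the jump times.\<close>

lemma word_event_sets [measurable]: "word_event i ws \<in> events"
proof -
  have "word_event i ws = {\<omega> \<in> space M. \<exists>n0. \<forall>n\<ge>n0. \<omega> \<in> skeleton_event i ws n}"
  proof (intro set_eqI iffI)
    fix \<omega> assume "\<omega> \<in> word_event i ws"
    moreover from this have "\<omega> \<in> space M" by (simp add: word_event_def)
    ultimately show "\<omega> \<in> {\<omega> \<in> space M. \<exists>n0. \<forall>n\<ge>n0. \<omega> \<in> skeleton_event i ws n}"
      using skeleton_event_eventually[of \<omega> i ws] by (auto simp: eventually_sequentially)
  next
    fix \<omega> assume "\<omega> \<in> {\<omega> \<in> space M. \<exists>n0. \<forall>n\<ge>n0. \<omega> \<in> skeleton_event i ws n}"
    then have "\<omega> \<in> space M" "\<forall>\<^sub>F n in sequentially. \<omega> \<in> skeleton_event i ws n"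
      by (auto simp: eventually_sequentially)
    from this(2) skeleton_event_eventually[OF this(1), of i ws]
    have "\<forall>\<^sub>F n in sequentially. \<omega> \<in> word_event i ws" by eventually_elim simp
    then show "\<omega> \<in> word_event i ws" by simp
  qed
  also have "\<dots> \<in> events" by measurable
  finally show ?thesis .
qed

text \<open>How fine the mesh has to be depends on the path, so the indicators converge only
  pointwise. Their bound 1 is enough for dominated convergence.\<close>

lemma prob_skeleton_event_tendsto:
  "(\<lambda>n. prob (skeleton_event i ws n)) \<longlonglongrightarrow> prob (word_event i ws)"
proof -
  have "(\<lambda>n. \<integral>\<omega>. indicator (skeleton_event i ws n) \<omega> \<partial>M) \<longlonglongrightarrow> (\<integral>\<omega>. indicator (word_event i ws) \<omega> \<partial>M :: real)"
  proof (rule integral_dominated_convergence[where w = "\<lambda>_. 1"])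
    show "AE \<omega> in M. (\<lambda>n. indicator (skeleton_event i ws n) \<omega>) \<longlonglongrightarrow> (indicator (word_event i ws) \<omega> :: real)"
    proof (rule AE_I2)
      fix \<omega> assume "\<omega> \<in> space M"
      from skeleton_event_eventually[OF this, of i ws]
      show "(\<lambda>n. indicator (skeleton_event i ws n) \<omega>) \<longlonglongrightarrow> (indicator (word_event i ws) \<omega> :: real)"
        by (intro tendsto_eventually) (auto elim!: eventually_mono simp: indicator_def)
    qed
  qed (auto simp: indicator_def)
  then show ?thesis by simp
qed

lemma transition_derivative:
  "((\<lambda>h. (p h i j - (if i = j then 1 else 0)) / h) \<longlongrightarrow> Q i j) (at_right 0)"
proof -
  have "((\<lambda>t. p t i j) has_real_derivative Q i j) (at 0 within {0<..})"
    using Q_function unfolding Q_function_def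
    by (intro has_field_derivative_subset[of _ _ 0 "{0..}" "{0<..}"]) auto
  moreover have "p 0 i j = (if i = j then 1 else 0)" using Q_function by (simp add: Q_function_def)
  ultimately show ?thesis by (simp add: has_field_derivative_iff)
qed

lemma eventually_transition_less_one:
  assumes "Q i i < 0"
  shows "\<forall>\<^sub>F h in at_right 0. p h i i < 1"
proof -
  have "\<forall>\<^sub>F h in at_right 0. (p h i i - 1) / h < 0"
    using order_tendstoD(2)[OF transition_derivative[of i i] assms] by simp
  moreover have "\<forall>\<^sub>F h in at_right (0::real). 0 < h" by (simp add: eventually_at_right_less)
  ultimately show ?thesis by eventually_elim (simp add: divide_less_0_iff)
qed

lemma eventually_leaving:
  "leaving (\<lambda>i. Q i i < 0) i ws \<Longrightarrow> \<forall>\<^sub>F h in at_right 0. leaving (\<lambda>i. p h i i < 1) i ws"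
  by (induction ws arbitrary: i) (auto intro!: eventually_conj eventually_transition_less_one)

lemma skeleton_prob_tendsto:
  "leaving (\<lambda>i. Q i i < 0) i ws \<Longrightarrow> ((\<lambda>h. skeleton_prob (p h) i ws) \<longlongrightarrow> embedded_prob Q i ws) (at_right 0)"
proof (induction ws arbitrary: i)
  case (Cons j ws)
  \<comment> \<open>Numerator and denominator both tend to 0; dividing each by \<open>h\<close>
    turns them into difference quotients at 0.\<close>
  have "((\<lambda>h. p h i j / h / - ((p h i i - 1) / h)) \<longlongrightarrow> Q i j / - Q i i) (at_right 0)"
    using transition_derivative[of i j] transition_derivative[of i i] Cons.prems
    by (intro tendsto_divide tendsto_minus) auto
  moreover have "\<forall>\<^sub>F h in at_right 0. p h i j / h / - ((p h i i - 1) / h) = p h i j / (1 - p h i i)"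
    by (rule eventually_mono[OF eventually_at_right_less[of 0]]) (simp add: minus_divide_left)
  ultimately have "((\<lambda>h. p h i j / (1 - p h i i)) \<longlongrightarrow> Q i j / - Q i i) (at_right 0)"
    by (rule Lim_transform_eventually)
  from tendsto_mult[OF this Cons.IH[of j]] Cons.prems show ?case
    by simp
qed simp

text \<open>
  The chain observed at the multiples of the mesh leaves a state after a geometric number of steps,
  and along each path its sequence of distinct states agrees with the jump chain for small meshes.
\<close>

theorem prob_word_event:
  assumes "leaving (\<lambda>i. Q i i < 0) i ws"
  shows "prob (word_event i ws) = prob {\<omega> \<in> space M. X 0 \<omega> = i} * embedded_prob Q i ws"
proof -
  have "\<forall>\<^sub>F n in sequentially. leaving (\<lambda>i. p (mesh n) i i < 1) i ws"
    by (rule eventually_compose_filterlim[OF eventually_leaving[OF assms] filterlim_mesh])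
  then have "\<forall>\<^sub>F n in sequentially. prob (skeleton_event i ws n) =
      prob {\<omega> \<in> space M. X 0 \<omega> = i} * skeleton_prob (p (mesh n)) i ws"
  proof eventually_elim
    case (elim n)
    have "prob {\<omega> \<in> space M. (\<forall>m\<le>0. X (real m * mesh n) \<omega> = i) \<and> skeleton_path (\<lambda>m. X (real (0 + m) * mesh n) \<omega>) ws} =
      prob {\<omega> \<in> space M. \<forall>m\<le>0. X (real m * mesh n) \<omega> = i} * skeleton_prob (p (mesh n)) i ws"
    proof (rule skeleton_path_prob[where z = "\<lambda>_. i" and Z = "\<lambda>m. X (real m * mesh n)" and P = "p (mesh n)" and n = 0])
      show "X (real m * mesh n) \<in> M \<rightarrow>\<^sub>M count_space UNIV" for m
        by (rule measurable_X) (use mesh_pos[of n] in simp)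
      show "prob {\<omega> \<in> space M. \<forall>m\<le>k. X (real m * mesh n) \<omega> = z m} =
        prob {\<omega> \<in> space M. X (real 0 * mesh n) \<omega> = z 0} * (\<Prod>m<k. p (mesh n) (z m) (z (Suc m)))" for k z
        using markov[of "\<lambda>m. real m * mesh n" k z] mesh_pos[of n]
        by (simp add: mult_right_mono left_diff_distrib[symmetric])
      show "0 \<le> p (mesh n) i i" for i
        using Q_function mesh_pos[of n] by (simp add: Q_function_def)
    qed (use elim in simp)
    then show ?case by (simp add: skeleton_event_def)
  qed
  moreover have "(\<lambda>n. prob {\<omega> \<in> space M. X 0 \<omega> = i} * skeleton_prob (p (mesh n)) i ws) \<longlonglongrightarrow>
      prob {\<omega> \<in> space M. X 0 \<omega> = i} * embedded_prob Q i ws"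
    by (intro tendsto_mult tendsto_const filterlim_compose[OF skeleton_prob_tendsto[OF assms] filterlim_mesh])
  ultimately have "(\<lambda>n. prob (skeleton_event i ws n)) \<longlonglongrightarrow> prob {\<omega> \<in> space M. X 0 \<omega> = i} * embedded_prob Q i ws"
    using tendsto_cong by force
  then show ?thesis using prob_skeleton_event_tendsto LIMSEQ_unique by blast
qed

end

section \<open>Hitting probabilities of a skip-free walk\<close>

definition splits :: "(nat \<Rightarrow>\<^sub>0 nat) \<Rightarrow> ((nat \<Rightarrow>\<^sub>0 nat) \<times> (nat \<Rightarrow>\<^sub>0 nat)) set" where
  "splits l = {(a, c). a + c = l}"

lemma splits_iff [simp]: "(a, c) \<in> splits l \<longleftrightarrow> a + c = l"
  by (simp add: splits_def)

lemma finite_splits [simp]: "finite (splits l)"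
proof -
  define D where "D = {a :: nat \<Rightarrow>\<^sub>0 nat. \<forall>k. Poly_Mapping.lookup a k \<le> Poly_Mapping.lookup l k}"
  \<comment> \<open>Both parts of a split lie coordinatewise below \<open>l\<close>. Hence they are
    functions supported on the keys of \<open>l\<close> and bounded by its largest entry, of which
    there are finitely many.\<close>
  define F where "F = {f :: nat \<Rightarrow> nat. \<forall>k. (k \<in> Poly_Mapping.keys l \<longrightarrow> f k \<in> {..Max (Poly_Mapping.lookup l ` Poly_Mapping.keys l)}) \<and> (k \<notin> Poly_Mapping.keys l \<longrightarrow> f k = 0)}"
  have "finite F" unfolding F_def by (rule finite_set_of_finite_funs) auto
  moreover have "Poly_Mapping.lookup ` D \<subseteq> F"
  proof (clarsimp simp: D_def F_def)
    fix a k assume a: "\<forall>k. Poly_Mapping.lookup a k \<le> Poly_Mapping.lookup l k"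
    have "Poly_Mapping.lookup a k \<le> Max (Poly_Mapping.lookup l ` Poly_Mapping.keys l)" if "k \<in> Poly_Mapping.keys l"
      by (rule order.trans[OF spec[OF a] Max_ge]) (use that in auto)
    moreover have "Poly_Mapping.lookup a k = 0" if "k \<notin> Poly_Mapping.keys l"
      using a that by (metis in_keys_iff le_zero_eq)
    ultimately show "(k \<in> Poly_Mapping.keys l \<longrightarrow> Poly_Mapping.lookup a k \<le> Max (Poly_Mapping.lookup l ` Poly_Mapping.keys l)) \<and> (k \<notin> Poly_Mapping.keys l \<longrightarrow> Poly_Mapping.lookup a k = 0)"
      by blast
  qed
  ultimately have "finite D"
    by (intro finite_imageD[OF finite_subset, of Poly_Mapping.lookup]) (auto simp: inj_on_def)
  moreover have "splits l \<subseteq> D \<times> D"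
    by (auto simp: splits_def D_def lookup_add)
  ultimately show ?thesis by (meson finite_SigmaI finite_subset)
qed

definition conv :: "((nat \<Rightarrow>\<^sub>0 nat) \<Rightarrow> real) \<Rightarrow> ((nat \<Rightarrow>\<^sub>0 nat) \<Rightarrow> real) \<Rightarrow> (nat \<Rightarrow>\<^sub>0 nat) \<Rightarrow> real" where
  "conv f g l = (\<Sum>(a, c)\<in>splits l. f a * g c)"

lemma splits_zero: "splits 0 = {(0, 0)}"
  by (auto simp: splits_def poly_mapping_eq_iff fun_eq_iff lookup_add)

lemma conv_zero: "conv f g 0 = f 0 * g 0"
  by (simp add: conv_def splits_zero)

lemma conv_unit: "conv (\<lambda>l. of_bool (l = 0)) g l = g l"
proof -
  have "conv (\<lambda>l. of_bool (l = 0)) g l = (\<Sum>p\<in>splits l. if p = (0, l) then g l else 0)"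
    unfolding conv_def by (intro sum.cong) (auto simp: splits_def)
  then show ?thesis by simp
qed

lemma conv_zero_left: "conv (\<lambda>_. 0) g l = 0"
  by (simp add: conv_def case_prod_unfold)

lemma conv_suminf:
  assumes "\<And>a. summable (\<lambda>d. F d a)"
  shows "summable (\<lambda>d. conv (F d) g l)"
    and "conv (\<lambda>a. suminf (\<lambda>d. F d a)) g l = suminf (\<lambda>d. conv (F d) g l)"
proof -
  have *: "summable (\<lambda>d. F d a * c)" for a c using assms by (rule summable_mult2)
  show "summable (\<lambda>d. conv (F d) g l)"
    unfolding conv_def by (intro summable_sum) (auto intro: *)
  have "conv (\<lambda>a. suminf (\<lambda>d. F d a)) g l = (\<Sum>(a, c)\<in>splits l. suminf (\<lambda>d. F d a * g c))"
    unfolding conv_def by (intro sum.cong) (auto simp: suminf_mult2 assms)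
  also have "\<dots> = (\<Sum>p\<in>splits l. suminf (\<lambda>d. F d (fst p) * g (snd p)))"
    by (simp add: case_prod_unfold)
  also have "\<dots> = suminf (\<lambda>d. \<Sum>p\<in>splits l. F d (fst p) * g (snd p))"
    by (rule suminf_sum[symmetric]) (rule *)
  finally show "conv (\<lambda>a. suminf (\<lambda>d. F d a)) g l = suminf (\<lambda>d. conv (F d) g l)"
    by (simp add: conv_def case_prod_unfold)
qed

lemma conv_mult: "conv (\<lambda>a. x * f a) g l = x * conv f g l"
  unfolding conv_def sum_distrib_left by (intro sum.cong) auto

text \<open>Multiplication of a power series by the variable with index \<open>d\<close>, if \<open>d\<close> is in \<open>N\<close>.\<close>

definition mult_var :: "nat set \<Rightarrow> nat \<Rightarrow> ((nat \<Rightarrow>\<^sub>0 nat) \<Rightarrow> real) \<Rightarrow> (nat \<Rightarrow>\<^sub>0 nat) \<Rightarrow> real" where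
  "mult_var N d f l = (if d \<in> N then if Poly_Mapping.lookup l d = 0 then 0 else f (l - unit_vec d) else f l)"

lemma mult_var_mono: "(\<And>l. f l \<le> g l) \<Longrightarrow> mult_var N d f l \<le> mult_var N d g l"
  by (auto simp: mult_var_def)

lemma mult_var_bounds:
  "(\<And>l. 0 \<le> f l) \<Longrightarrow> 0 \<le> mult_var N d f l"
  "(\<And>l. f l \<le> 1) \<Longrightarrow> mult_var N d f l \<le> 1"
  by (auto simp: mult_var_def)

lemma mult_var_zero: "mult_var N d f 0 = (if d \<in> N then 0 else f 0)"
  by (simp add: mult_var_def)

lemma minus_unit_vec:
  "Poly_Mapping.lookup l d \<noteq> 0 \<Longrightarrow> l - unit_vec d + unit_vec d = l"
  by (rule poly_mapping_eqI) (auto simp: lookup_add lookup_minus lookup_single when_def)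

text \<open>A variable in front of a product may be given to the left factor. In coefficients this
  shifts the first part of each split by \<open>unit_vec d\<close>; the splits that are not reached
  have coordinate \<open>d\<close> equal to 0 in the first part and contribute 0.\<close>

lemma mult_var_conv: "mult_var N d (conv f g) l = conv (mult_var N d f) g l"
proof (cases "d \<in> N")
  case True
  show ?thesis
  proof (cases "Poly_Mapping.lookup l d = 0")
    case False
    define l' where "l' = l - unit_vec d"
    have l: "l = l' + unit_vec d" using minus_unit_vec[OF False] by (simp add: l'_def)
    have "conv f g l' = (\<Sum>p\<in>{p \<in> splits l. Poly_Mapping.lookup (fst p) d \<noteq> 0}. f (fst p - unit_vec d) * g (snd p))"
      unfolding conv_def
    proof (rule sum.reindex_bij_witness[where j = "\<lambda>(a, c). (a + unit_vec d, c)"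
          and i = "\<lambda>(a, c). (a - unit_vec d, c)"], goal_cases)
      case (4 p)
      then have "fst p - unit_vec d + unit_vec d + snd p = l' + unit_vec d"
        using minus_unit_vec[of "fst p" d] l by (cases p) auto
      then have "fst p - unit_vec d + snd p = l'"
        by (metis (no_types, lifting) add.assoc add.commute add_right_imp_eq)
      then show ?case by (cases p) auto
    qed (auto simp: l lookup_add lookup_single trans[OF add.commute minus_unit_vec, unfolded One_nat_def] algebra_simps)
    also have "\<dots> = (\<Sum>p\<in>splits l. mult_var N d f (fst p) * g (snd p))"
      using True by (intro sum.mono_neutral_cong_left) (auto simp: mult_var_def)
    finally show ?thesis
      using True False by (simp add: mult_var_def conv_def case_prod_unfold l'_def)
  next
    case z: True
    have "conv (mult_var N d f) g l = 0"
      unfolding conv_def using True z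
      by (intro sum.neutral) (auto simp: mult_var_def splits_def lookup_add)
    then show ?thesis using True z by (simp add: mult_var_def)
  qed
qed (simp add: mult_var_def[abs_def])

section \<open>Hitting probabilities as coefficients of a power series\<close>

locale offspring =
  fixes q :: "nat \<Rightarrow> real" and N :: "nat set"
  assumes q_nonneg: "\<And>d. 0 \<le> q d" and q_sums: "q sums 1" and q_one: "q 1 = 0"
begin

text \<open>
  The probability that the walk starting from \<open>i\<close> with steps \<open>d - 1\<close> of probability \<open>q d\<close> reaches
  \<open>0\<close> within \<open>n\<close> steps and that \<open>l\<close> counts those with \<open>d \<in> N\<close>.
\<close>

fun hit_within :: "nat \<Rightarrow> nat \<Rightarrow> (nat \<Rightarrow>\<^sub>0 nat) \<Rightarrow> real" where
  "hit_within 0 i l = of_bool (i = 0 \<and> l = 0)"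
| "hit_within (Suc n) i l =
     (if i = 0 then of_bool (l = 0) else suminf (\<lambda>d. q d * mult_var N d (hit_within n (i + d - 1)) l))"

lemma hit_within_start_zero [simp]: "hit_within n 0 l = of_bool (l = 0)"
  by (cases n) auto

lemma q_summable: "summable q"
  using q_sums by (simp add: sums_iff)

lemma summable_q_mult:
  assumes "\<And>d. 0 \<le> f d" "\<And>d. f d \<le> 1"
  shows "summable (\<lambda>d. q d * f d)"
  by (rule summable_comparison_test'[OF q_summable, of 0])
     (use q_nonneg assms in \<open>auto simp: abs_mult intro!: mult_left_le\<close>)

lemma suminf_q_mult_le: 
  assumes "\<And>d. 0 \<le> f d" "\<And>d. f d \<le> 1"
  shows "suminf (\<lambda>d. q d * f d) \<le> 1"
proof -
  have "suminf (\<lambda>d. q d * f d) \<le> suminf (\<lambda>d. q d)"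
    using assms by (intro suminf_le summable_q_mult q_summable) (auto intro!: mult_left_le q_nonneg)
  then show ?thesis using q_sums by (simp add: sums_iff)
qed

lemma hit_within_bounds: "0 \<le> hit_within n i l \<and> hit_within n i l \<le> 1"
proof (induction n arbitrary: i l)
  case (Suc n)
  have s: "0 \<le> mult_var N d (hit_within n j) l" "mult_var N d (hit_within n j) l \<le> 1" for d j
    using Suc by (auto intro!: mult_var_bounds)
  show ?case
    using s by (auto intro!: suminf_q_mult_le suminf_nonneg summable_q_mult mult_nonneg_nonneg q_nonneg)
qed auto

lemma mult_var_hit_within_bounds:
  "0 \<le> mult_var N d (hit_within n i) l" "mult_var N d (hit_within n i) l \<le> 1"
  using hit_within_bounds by (auto intro!: mult_var_bounds)

lemma hit_within_mono_Suc: "hit_within n i l \<le> hit_within (Suc n) i l"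
proof (induction n arbitrary: i l)
  case 0
  show ?case using hit_within_bounds[of 1 i l] by (cases i) auto
next
  case (Suc n)
  show ?case
    unfolding hit_within.simps(2)[of "Suc n"] hit_within.simps(2)[of n i]
    using Suc by (auto intro!: suminf_le summable_q_mult mult_var_hit_within_bounds mult_left_mono mult_var_mono q_nonneg
      simp del: hit_within.simps)
qed

definition hit :: "nat \<Rightarrow> (nat \<Rightarrow>\<^sub>0 nat) \<Rightarrow> real" where
  "hit i l = lim (\<lambda>n. hit_within n i l)"

lemma incseq_hit_within: "incseq (\<lambda>n. hit_within n i l)"
  by (rule incseq_SucI) (rule hit_within_mono_Suc)

lemma hit_within_tendsto: "(\<lambda>n. hit_within n i l) \<longlonglongrightarrow> hit i l"
proof -
  have "convergent (\<lambda>n. hit_within n i l)"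
    using hit_within_bounds incseq_hit_within
    by (intro Bseq_mono_convergent[OF BseqI'[of _ 1]]) (auto simp: incseq_def)
  then show ?thesis unfolding hit_def by (simp add: convergent_LIMSEQ_iff)
qed

lemma hit_within_le_hit: "hit_within n i l \<le> hit i l"
  using incseq_hit_within hit_within_tendsto by (rule incseq_le)

lemma hit_nonneg: "0 \<le> hit i l"
  by (rule order.trans[OF _ hit_within_le_hit[of 0]]) simp

lemma hit_le_one: "hit i l \<le> 1"
  using hit_within_bounds by (intro LIMSEQ_le_const2[OF hit_within_tendsto]) auto

lemma mult_var_hit_bounds: "0 \<le> mult_var N d (hit i) l" "mult_var N d (hit i) l \<le> 1"
  using hit_nonneg hit_le_one by (auto intro!: mult_var_bounds)

lemma hit_start_zero: "hit 0 l = of_bool (l = 0)"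
  by (simp add: hit_def)

text \<open>The limit in \<open>n\<close> passes through the series over the first step because the
  summable \<open>q\<close> dominates all terms.\<close>

lemma hit_step:
  assumes "0 < i"
  shows "hit i l = suminf (\<lambda>d. q d * mult_var N d (hit (i + d - 1)) l)"
proof -
  have "(\<lambda>n. hit_within (Suc n) i l) \<longlonglongrightarrow> suminf (\<lambda>d. q d * mult_var N d (hit (i + d - 1)) l)"
    unfolding hit_within.simps using assms
  proof (simp, intro tannerys_theorem[where M = q and F = sequentially, THEN conjunct2, THEN conjunct2])
    fix d
    have "(\<lambda>n. mult_var N d (hit_within n (i + d - 1)) l) \<longlonglongrightarrow> mult_var N d (hit (i + d - 1)) l"
      by (auto simp: mult_var_def hit_within_tendsto)
    from tendsto_mult_left[OF this]
    show "(\<lambda>n. q d * mult_var N d (hit_within n (i + d - Suc 0)) l) \<longlonglongrightarrow> q d * mult_var N d (hit (i + d - Suc 0)) l"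
      by simp
  next
    have "norm (q d * mult_var N d (hit_within n (i + d - Suc 0)) l) \<le> q d" for d n
      using mult_var_hit_within_bounds q_nonneg by (auto simp: abs_mult intro!: mult_left_le)
    then show "\<forall>\<^sub>F (d, n) in sequentially \<times>\<^sub>F sequentially.
       norm (q d * mult_var N d (hit_within n (i + d - Suc 0)) l) \<le> q d"
      by (intro always_eventually) auto
  qed (use q_summable in auto)
  moreover have "(\<lambda>n. hit_within (Suc n) i l) \<longlonglongrightarrow> hit i l"
    by (rule LIMSEQ_Suc[OF hit_within_tendsto])
  ultimately show ?thesis using LIMSEQ_unique by blast
qed

text \<open>Convolution is linear and lets a variable pass to the left factor, so it commutes with a
  first-step decomposition.\<close>

lemma conv_step:
  assumes "\<And>d a. 0 \<le> F d a" "\<And>d a. F d a \<le> 1"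
  shows "conv (\<lambda>l. suminf (\<lambda>d. q d * mult_var N d (F d) l)) g l = suminf (\<lambda>d. q d * mult_var N d (conv (F d) g) l)"
    and "summable (\<lambda>d. q d * mult_var N d (conv (F d) g) l)"
proof -
  have *: "summable (\<lambda>d. q d * mult_var N d (F d) a)" for a
    by (intro summable_q_mult mult_var_bounds assms)
  show "conv (\<lambda>l. suminf (\<lambda>d. q d * mult_var N d (F d) l)) g l = suminf (\<lambda>d. q d * mult_var N d (conv (F d) g) l)"
    unfolding conv_suminf(2)[OF *] conv_mult mult_var_conv ..
  show "summable (\<lambda>d. q d * mult_var N d (conv (F d) g) l)"
    using conv_suminf(1)[OF *] unfolding conv_mult mult_var_conv .
qed

text \<open>The number of steps is bounded in the left factor only. A step from \<open>i > 0\<close>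
  is then also a step from \<open>i + k\<close>, with the right factor untouched, and the induction
  ends at \<open>i = 0\<close>, where the left factor is the unit of convolution. The reverse bound
  below has the same structure.\<close>

lemma conv_hit_within_le: "conv (hit_within n i) (hit k) l \<le> hit (i + k) l"
proof (induction n arbitrary: i l)
  case 0
  show ?case
  proof (cases "i = 0")
    case True
    then have "hit_within 0 i = (\<lambda>l. of_bool (l = 0))" by auto
    then show ?thesis using True by (simp only: conv_unit) simp
  next
    case False
    then have "hit_within 0 i = (\<lambda>_. 0)" by auto
    then show ?thesis by (simp only: conv_zero_left hit_nonneg)
  qed
next
  case (Suc n)
  show ?case
  proof (cases "i = 0")
    case True
    then have "hit_within (Suc n) i = (\<lambda>l. of_bool (l = 0))" by auto
    then show ?thesis using True by (simp only: conv_unit) simp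
  next
    case False
    then have "hit_within (Suc n) i = (\<lambda>l. suminf (\<lambda>d. q d * mult_var N d (hit_within n (i + d - 1)) l))" by auto
    then have "conv (hit_within (Suc n) i) (hit k) l = suminf (\<lambda>d. q d * mult_var N d (conv (hit_within n (i + d - 1)) (hit k)) l)"
      using conv_step(1)[of "\<lambda>d. hit_within n (i + d - 1)"] hit_within_bounds by simp
    also have "\<dots> \<le> suminf (\<lambda>d. q d * mult_var N d (hit (i + k + d - 1)) l)"
    proof (intro suminf_le mult_left_mono mult_var_mono q_nonneg conv_step(2) summable_q_mult mult_var_hit_bounds)
      fix d l
      have "i + d - 1 + k = i + k + d - 1" using False by simp
      then show "conv (hit_within n (i + d - 1)) (hit k) l \<le> hit (i + k + d - 1) l"
        using Suc[of "i + d - 1" l] by simp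
    qed (use hit_within_bounds in auto)
    also have "\<dots> = hit (i + k) l" using False by (subst hit_step[of "i + k"]) auto
    finally show ?thesis .
  qed
qed

lemma hit_within_le_conv: "hit_within n (i + k) l \<le> conv (hit_within n i) (hit k) l"
proof (induction n arbitrary: i l)
  case 0
  show ?case
  proof (cases "i = 0")
    case True
    then have "hit_within 0 i = (\<lambda>l. of_bool (l = 0))" by auto
    then show ?thesis using True hit_within_le_hit[of 0 k l] by (simp only: conv_unit) simp
  next
    case False
    then show ?thesis by (auto simp: conv_def)
  qed
next
  case (Suc n)
  show ?case
  proof (cases "i = 0")
    case True
    then have "hit_within (Suc n) i = (\<lambda>l. of_bool (l = 0))" by auto
    then show ?thesis using True hit_within_le_hit[of "Suc n" k l] by (simp only: conv_unit add_0)
  next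
    case False
    then have *: "hit_within (Suc n) i = (\<lambda>l. suminf (\<lambda>d. q d * mult_var N d (hit_within n (i + d - 1)) l))" by auto
    have "hit_within (Suc n) (i + k) l = suminf (\<lambda>d. q d * mult_var N d (hit_within n (i + k + d - 1)) l)"
      using False by simp
    also have "\<dots> \<le> suminf (\<lambda>d. q d * mult_var N d (conv (hit_within n (i + d - 1)) (hit k)) l)"
    proof (intro suminf_le mult_left_mono mult_var_mono q_nonneg conv_step(2) summable_q_mult mult_var_hit_within_bounds)
      fix d l
      have "i + d - 1 + k = i + k + d - 1" using False by simp
      then show "hit_within n (i + k + d - 1) l \<le> conv (hit_within n (i + d - 1)) (hit k) l"
        using Suc[of "i + d - 1" l] by simp
    qed (use hit_within_bounds in auto)
    also have "\<dots> = conv (hit_within (Suc n) i) (hit k) l"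
      unfolding * using conv_step(1)[of "\<lambda>d. hit_within n (i + d - 1)"] hit_within_bounds by simp
    finally show ?thesis .
  qed
qed

text \<open>Steps go down by at most one, so hitting \<open>0\<close> from \<open>i + k\<close> means hitting \<open>k\<close> first.\<close>

lemma hit_add: "hit (i + k) l = conv (hit i) (hit k) l"
proof (rule antisym)
  have *: "(\<lambda>n. conv (hit_within n i) (hit k) l) \<longlonglongrightarrow> conv (hit i) (hit k) l"
    unfolding conv_def case_prod_unfold by (intro tendsto_intros hit_within_tendsto)
  show "conv (hit i) (hit k) l \<le> hit (i + k) l"
    using * by (rule LIMSEQ_le_const2) (use conv_hit_within_le in auto)
  show "hit (i + k) l \<le> conv (hit i) (hit k) l"
    using hit_within_tendsto * by (rule LIMSEQ_le) (use hit_within_le_conv in auto)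
qed

lemma hit_zero_power: "hit i 0 = hit 1 0 ^ i"
proof (induction i)
  case (Suc i)
  then show ?case using hit_add[of 1 i 0] by (simp add: conv_zero)
qed (simp add: hit_start_zero)

lemma hit_zero_step: "hit 1 0 = suminf (\<lambda>d. if d \<in> N then 0 else q d * hit 1 0 ^ d)"
proof -
  have "hit 1 0 = suminf (\<lambda>d. q d * mult_var N d (hit d) 0)"
    using hit_step[of 1 0] by simp
  also have "\<dots> = suminf (\<lambda>d. if d \<in> N then 0 else q d * hit 1 0 ^ d)"
    unfolding mult_var_zero hit_zero_power[symmetric] by (intro suminf_cong) simp
  finally show ?thesis .
qed

text \<open>The sequence \<open>u ^ i\<close> solves the first-step equation for unmarked steps and
  has the value 1 at 0. It therefore dominates all iterates, which start from the smallest values.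
  The bound is proved for every \<open>i\<close> because one step leads from 1 to arbitrary
  states.\<close>

lemma hit_zero_le:
  assumes u: "0 \<le> u" "u \<le> 1" "u = suminf (\<lambda>d. if d \<in> N then 0 else q d * u ^ d)"
  shows "hit 1 0 \<le> u"
proof -
  have "hit_within n i 0 \<le> u ^ i" for n i
  proof (induction n arbitrary: i)
    case 0
    then show ?case using u by (cases i) auto
  next
    case (Suc n)
    show ?case
    proof (cases i)
      case (Suc i')
      have pow: "0 \<le> u ^ d \<and> u ^ d \<le> 1" for d using u by (simp add: power_le_one)
      have s: "summable (\<lambda>d. q d * (if d \<in> N then 0 else u ^ d))"
        using pow by (intro summable_q_mult) auto
      have "hit_within (Suc n) i 0 = suminf (\<lambda>d. q d * mult_var N d (hit_within n (i' + d)) 0)"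
        using Suc by simp
      also have "\<dots> \<le> suminf (\<lambda>d. u ^ i' * (q d * (if d \<in> N then 0 else u ^ d)))"
      proof (intro suminf_le summable_mult s summable_q_mult mult_var_hit_within_bounds)
        fix d
        show "q d * mult_var N d (hit_within n (i' + d)) 0 \<le> u ^ i' * (q d * (if d \<in> N then 0 else u ^ d))"
          using mult_left_mono[OF Suc.IH[of "i' + d"] q_nonneg[of d]]
          by (auto simp: mult_var_zero power_add mult_ac)
      qed
      also have "\<dots> = u ^ i' * suminf (\<lambda>d. q d * (if d \<in> N then 0 else u ^ d))"
        by (rule suminf_mult[OF s])
      also have "suminf (\<lambda>d. q d * (if d \<in> N then 0 else u ^ d)) = u"
        by (subst (2) u(3)) (auto intro!: suminf_cong)
      finally show ?thesis using Suc by (simp add: mult.commute)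
    qed auto
  qed
  from this[of _ 1] show ?thesis by (intro LIMSEQ_le_const2[OF hit_within_tendsto]) auto
qed

end

section \<open>Convolution powers as iterated products\<close>

lemma decompositions_Suc:
  "decompositions (Suc j) l = (\<lambda>((a, c), ls). a # ls) ` (SIGMA p:splits l. decompositions j (snd p))"
proof (rule antisym)
  show "decompositions (Suc j) l \<subseteq> (\<lambda>((a, c), ls). a # ls) ` (SIGMA p:splits l. decompositions j (snd p))"
  proof
    fix xs assume "xs \<in> decompositions (Suc j) l"
    then obtain a ls where "xs = a # ls" "length ls = j" "a + sum_list ls = l"
      by (cases xs) (auto simp: decompositions_def)
    then show "xs \<in> (\<lambda>((a, c), ls). a # ls) ` (SIGMA p:splits l. decompositions j (snd p))"
      by (intro image_eqI[of _ _ "((a, sum_list ls), ls)"]) (auto simp: decompositions_def)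
  qed
qed (auto simp: decompositions_def)

lemma inj_on_decompositions:
  "inj_on (\<lambda>((a, c), ls). a # ls) (SIGMA p:splits l. decompositions j (snd p))"
  by (auto simp: inj_on_def decompositions_def)

lemma decompositions_0: "decompositions 0 l = (if l = 0 then {[]} else {})"
  by (auto simp: decompositions_def)

lemma finite_decompositions [simp]: "finite (decompositions j l)"
  by (induction j arbitrary: l) (auto simp: decompositions_0 decompositions_Suc)

lemma conv_power_0: "conv_power r 0 l = of_bool (l = 0)"
  by (simp add: conv_power_def decompositions_0)

lemma conv_power_Suc: "conv_power r (Suc j) l = conv r (conv_power r j) l"
proof -
  have "conv_power r (Suc j) l =
      (\<Sum>(p, ls)\<in>(SIGMA p:splits l. decompositions j (snd p)). r (fst p) * prod_list (map r ls))"
    unfolding conv_power_def decompositions_Suc sum.reindex[OF inj_on_decompositions]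
    by (intro sum.cong) auto
  also have "\<dots> = (\<Sum>p\<in>splits l. \<Sum>ls\<in>decompositions j (snd p). r (fst p) * prod_list (map r ls))"
    by (rule sum.Sigma[symmetric]) auto
  finally show ?thesis
    by (simp add: conv_def conv_power_def sum_distrib_left case_prod_unfold)
qed

lemma (in offspring) conv_power_hit: "conv_power (hit 1) j = hit j"
proof (induction j)
  case (Suc j)
  show ?case
    by (rule ext) (use hit_add[of 1 j] in \<open>simp only: conv_power_Suc Suc plus_1_eq_Suc\<close>)
qed (simp add: fun_eq_iff conv_power_0 hit_start_zero)

section \<open>Convolution powers and the recursions\<close>

lemma total_eq_sum: "finite S \<Longrightarrow> Poly_Mapping.keys l \<subseteq> S \<Longrightarrow> total l = (\<Sum>k\<in>S. Poly_Mapping.lookup l k)"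
  unfolding total_def by (rule sum.mono_neutral_left) (auto simp: in_keys_iff)

lemma total_add: "total (a + c) = total a + total c"
proof -
  define S where "S = Poly_Mapping.keys a \<union> Poly_Mapping.keys c \<union> Poly_Mapping.keys (a + c)"
  have "finite S" "Poly_Mapping.keys a \<subseteq> S" "Poly_Mapping.keys c \<subseteq> S" "Poly_Mapping.keys (a + c) \<subseteq> S" by (auto simp: S_def)
  then show ?thesis by (simp add: total_eq_sum[of S] lookup_add sum.distrib)
qed

lemma total_eq_0_iff: "total l = 0 \<longleftrightarrow> l = 0"
  by (auto simp: total_def in_keys_iff) (metis in_keys_iff poly_mapping_eqI lookup_zero)

lemma total_zero [simp]: "total 0 = 0"
  by (simp add: total_eq_0_iff)

lemma total_unit_vec [simp]: "total (unit_vec k) = 1" "total (Poly_Mapping.single k (Suc 0)) = 1"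
  by (simp_all add: total_def)

lemma unit_vec_neq_zero: "unit_vec k \<noteq> 0" "Poly_Mapping.single k (Suc 0) \<noteq> 0"
  using total_unit_vec[of k] by (auto simp flip: total_eq_0_iff)

text \<open>Cutting off the family turns the restriction on the summands in
  \<open>bounded_conv_power\<close> into an ordinary convolution power, which obeys the recursion
  \<open>conv_power_Suc\<close>.\<close>

definition truncate :: "nat \<Rightarrow> ((nat \<Rightarrow>\<^sub>0 nat) \<Rightarrow> real) \<Rightarrow> (nat \<Rightarrow>\<^sub>0 nat) \<Rightarrow> real" where
  "truncate n r a = (if total a \<le> n then r a else 0)"

lemma bounded_conv_power_eq: "bounded_conv_power r n j l = conv_power (truncate n r) j l"
proof -
  have "prod_list (map (truncate n r) ls) = (if \<forall>a\<in>set ls. total a \<le> n then prod_list (map r ls) else 0)" for ls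
    by (induction ls) (auto simp: truncate_def)
  then show ?thesis
    unfolding bounded_conv_power_def conv_power_def
    by (simp add: sum.inter_filter[symmetric])
qed

lemma conv_power_cong:
  assumes "\<And>a c. a + c = l \<Longrightarrow> r a = r' a"
  shows "conv_power r j l = conv_power r' j l"
  using assms
proof (induction j arbitrary: l)
  case (Suc j)
  show ?case
    unfolding conv_power_Suc conv_def
  proof (intro sum.cong refl, clarify)
    fix a c assume "(a, c) \<in> splits l"
    then have l: "a + c = l" by simp
    have "conv_power r j c = conv_power r' j c"
    proof (rule Suc.IH)
      fix a' c' assume "a' + c' = c"
      then have "a' + (a + c') = l" using l by (metis add.left_commute)
      then show "r a' = r' a'" by (rule Suc.prems)
    qed
    then show "r a * conv_power r j c = r' a * conv_power r' j c"
      using Suc.prems[OF l] by simp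
  qed
qed (simp add: conv_power_0)

lemma conv_power_truncate: "total l \<le> n \<Longrightarrow> conv_power (truncate n r) j l = conv_power r j l"
  by (rule conv_power_cong) (auto simp: truncate_def total_add)

lemma conv_power_at_zero: "conv_power r j 0 = r 0 ^ j"
  by (induction j) (simp_all add: conv_power_0 conv_power_Suc conv_zero)

text \<open>The decompositions missing in the bounded power have one summand \<open>l\<close> and the others \<open>0\<close>.\<close>

lemma conv_power_split:
  assumes l: "total l = Suc n"
  shows "conv_power r j l = bounded_conv_power r n j l + real j * r 0 ^ (j - 1) * r l"
  unfolding bounded_conv_power_eq
proof (induction j)
  case (Suc j)
  let ?t = "truncate n r"
  have l0: "l \<noteq> 0" using l by auto
  have t: "?t l = 0" "?t 0 = r 0" using l by (auto simp: truncate_def)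
  define R where "R = splits l - {(l, 0), (0, l)}"
  have R: "splits l = insert (l, 0) (insert (0, l) R)" "(l, 0) \<notin> insert (0, l) R" "(0, l) \<notin> R" "finite R"
    using l0 by (auto simp: R_def)
  have eq: "(\<Sum>(a, c)\<in>R. r a * conv_power r j c) = (\<Sum>(a, c)\<in>R. ?t a * conv_power ?t j c)"
  proof (intro sum.cong refl, clarify)
    fix a c assume "(a, c) \<in> R"
    then have ac: "a + c = l" "a \<noteq> 0" "c \<noteq> 0" by (auto simp: R_def)
    then have "total a \<noteq> 0" "total c \<noteq> 0" "total a + total c = Suc n"
      using l by (auto simp: total_eq_0_iff simp flip: total_add)
    then have "total a \<le> n" "total c \<le> n" by auto
    then show "r a * conv_power r j c = ?t a * conv_power ?t j c"
      by (simp add: truncate_def conv_power_truncate)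
  qed
  \<comment> \<open>For \<open>j = 0\<close> the exponent is truncated, but the factor
    \<open>real j\<close> makes both sides 0.\<close>
  have "r 0 * (real j * r 0 ^ (j - 1) * r l) = real j * r 0 ^ j * r l"
    by (cases j) auto
  then show ?case
    unfolding conv_power_Suc conv_def R(1)
    using R(2-) eq t by (simp add: Suc conv_power_at_zero distrib_left distrib_right del: mult_eq_0_iff mult_cancel_right mult_cancel_left)
qed (simp add: conv_power_0)

lemma vecs_split:
  assumes "l \<in> vecs N" "l \<noteq> 0"
  obtains l' k where "l' \<in> vecs N" "k \<in> N" "l = l' + unit_vec k"
proof -
  obtain k where k: "Poly_Mapping.lookup l k \<noteq> 0" using assms(2) by (metis poly_mapping_eqI lookup_zero)
  have "Poly_Mapping.keys (l - unit_vec k) \<subseteq> Poly_Mapping.keys l"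
    by (auto simp: in_keys_iff lookup_minus)
  then show ?thesis
    using assms(1) k minus_unit_vec[OF k]
    by (intro that[of "l - unit_vec k" k]) (auto simp: vecs_def in_keys_iff)
qed

lemma keys_add_nat: "Poly_Mapping.keys (a + c) = Poly_Mapping.keys a \<union> Poly_Mapping.keys (c :: nat \<Rightarrow>\<^sub>0 nat)"
  by (auto simp: in_keys_iff lookup_add)

lemma vecs_add_iff: "a + c \<in> vecs N \<longleftrightarrow> a \<in> vecs N \<and> c \<in> vecs N"
  by (auto simp: vecs_def keys_add_nat)

lemma is_min_root_unique: "is_min_root f u \<Longrightarrow> is_min_root f u' \<Longrightarrow> u = u'"
  by (fastforce simp: is_min_root_def intro: antisym)

text \<open>In the equation for a nonzero \<open>l\<close> the right-hand side involves the family
  only at vectors of smaller total, and at 0, where the minimal root is unique. Any choice of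
  \<open>k\<close> with \<open>l = l' + unit_vec k\<close> serves, as long as it is the same for
  both families.\<close>

lemma crossing_recursion_summed_unique:
  assumes "crossing_recursion_summed b N r" "crossing_recursion_summed b N r'" "l \<in> vecs N"
  shows "r l = r' l"
  using assms(3)
proof (induction "total l" arbitrary: l rule: less_induct)
  case less
  have r0: "r 0 = r' 0"
    using assms is_min_root_unique by (auto simp: crossing_recursion_summed_def)
  show ?case
  proof (cases "l = 0")
    case False
    then obtain l' k where l: "l' \<in> vecs N" "k \<in> N" "l = l' + unit_vec k"
      using vecs_split less.prems by metis
    have tl: "total l = Suc (total l')" by (simp add: l total_add)
    have eq: "r a = r' a" if "a + c = l" "total a \<le> total l'" for a c
      by (rule less.hyps) (use that tl less.prems vecs_add_iff in auto)
    have 1: "bounded_conv_power r (total l') j l = bounded_conv_power r' (total l') j l" for j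
      unfolding bounded_conv_power_eq
      by (rule conv_power_cong) (auto simp: truncate_def intro: eq)
    have 2: "conv_power r m (l - unit_vec m) = conv_power r' m (l - unit_vec m)" if "m \<in> Poly_Mapping.keys l" for m
    proof (rule conv_power_cong)
      fix a c assume ac: "a + c = l - unit_vec m"
      then have ac': "a + (c + unit_vec m) = l"
        using minus_unit_vec[of l m] that by (simp add: add.assoc[symmetric] in_keys_iff)
      have "total a + total c + 1 = Suc (total l')"
        using arg_cong[OF ac', of total] tl by (simp add: total_add)
      then show "r a = r' a" using eq[OF ac'] by simp
    qed
    have "r l = - (suminf (\<lambda>j. if j \<in> N \<union> {1} then 0 else b j * bounded_conv_power r (total l') j l)
             + (\<Sum>m\<in>Poly_Mapping.keys l. b m * conv_power r m (l - unit_vec m))) / deriv (B_bar b N) (r 0)"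
      using assms(1) l unfolding crossing_recursion_summed_def by blast
    also have "\<dots> = - (suminf (\<lambda>j. if j \<in> N \<union> {1} then 0 else b j * bounded_conv_power r' (total l') j l)
             + (\<Sum>m\<in>Poly_Mapping.keys l. b m * conv_power r' m (l - unit_vec m))) / deriv (B_bar b N) (r' 0)"
    proof -
      have sum: "(\<Sum>m\<in>Poly_Mapping.keys l. b m * conv_power r m (l - unit_vec m))
          = (\<Sum>m\<in>Poly_Mapping.keys l. b m * conv_power r' m (l - unit_vec m))"
        by (rule sum.cong[OF refl]) (simp only: 2)
      show ?thesis unfolding sum 1 r0 ..
    qed
    also have "\<dots> = r' l"
      by (rule sym) (use assms(2) l in \<open>unfold crossing_recursion_summed_def, blast\<close>)
    finally show ?thesis .
  qed (use r0 in simp)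
qed

text \<open>Convexity of the \<open>j\<close>-th power on \<open>{0..1}\<close>: its tangent at
  \<open>u\<close>, evaluated at 1, stays below the value 1.\<close>

lemma bernoulli_tangent:
  fixes u :: real
  assumes "0 \<le> u" "u \<le> 1"
  shows "u ^ j + real j * u ^ (j - 1) * (1 - u) \<le> 1"
proof (induction j)
  case (Suc j)
  have "u ^ Suc j + real (Suc j) * u ^ (Suc j - 1) * (1 - u)
      = u * (u ^ j + real j * u ^ (j - 1) * (1 - u)) + u ^ j * (1 - u)"
    by (cases j) (simp_all add: algebra_simps)
  also have "\<dots> \<le> u * 1 + 1 * (1 - u)"
    using Suc assms by (intro add_mono mult_left_mono mult_right_mono) (auto simp: power_le_one)
  finally show ?case by simp
qed simp

section \<open>The function \<open>B_bar\<close> and the recursion for the hitting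
  probabilities\<close>

locale branching =
  fixes b :: "nat \<Rightarrow> real" and N :: "nat set"
  assumes b_nonneg: "\<And>j. j \<noteq> 1 \<Longrightarrow> 0 \<le> b j"
    and b_one: "b 1 < 0"
    and b_sums: "(\<lambda>j. if j = 1 then 0 else b j) sums (- b 1)"
    and finite_N: "finite N" and one_notin_N: "1 \<notin> N" and b_pos: "\<And>k. k \<in> N \<Longrightarrow> 0 < b k"
begin

text \<open>The jump law: rates divided by the total exit rate, in which the weights cancel. Index 1
  stands for the diagonal of the \<open>Q\<close>-matrix and is no jump.\<close>

definition q :: "nat \<Rightarrow> real" where
  "q d = (if d = 1 then 0 else b d / - b 1)"

sublocale offspring q N
proof
  show "0 \<le> q d" for d
    unfolding q_def using b_nonneg b_one by (auto intro!: divide_nonneg_neg simp: divide_nonneg_neg)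
  show "q 1 = 0" by (simp add: q_def)
  have "(\<lambda>d. (if d = 1 then 0 else b d) / - b 1) sums (- b 1 / - b 1)"
    using b_sums by (rule sums_divide)
  also have "(\<lambda>d. (if d = 1 then 0 else b d) / - b 1) = q" by (auto simp: q_def)
  finally show "q sums 1" using b_one by simp
qed

lemma b_eq_q: "j \<noteq> 1 \<Longrightarrow> b j = - b 1 * q j"
  using b_one by (simp add: q_def)

lemma b_sums_zero: "b sums 0"
proof -
  have "(\<lambda>j. if j = 1 then b 1 else 0) sums b 1"
    using sums_single[of 1 b] by (rule sums_cong[THEN iffD1, rotated]) simp
  from sums_add[OF b_sums this]
  have "(\<lambda>n. (if n = 1 then 0 else b n) + (if n = 1 then b 1 else 0)) sums 0" by simp
  then show ?thesis
    by (rule sums_cong[THEN iffD1, rotated]) auto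
qed

lemma summable_coeff: "summable (\<lambda>j. if j \<in> N then 0 else b j)"
proof -
  have "summable (\<lambda>j. if j \<in> N then b j else 0)"
    by (rule summable_finite[OF finite_N]) auto
  from summable_diff[OF sums_summable[OF b_sums_zero] this] show ?thesis
    by (rule summable_cong[THEN iffD1, rotated]) auto
qed

text \<open>The term with index 1 supplies \<open>- u\<close>, the others the generating function of
  the unmarked steps. Roots of \<open>B_bar\<close> are thus fixed points of that function.\<close>

lemma B_bar_eq:
  assumes "0 \<le> u" "u \<le> 1"
  shows "B_bar b N u = - b 1 * (suminf (\<lambda>d. if d \<in> N then 0 else q d * u ^ d) - u)"
    and "summable (\<lambda>j. if j \<in> N then 0 else b j * u ^ j)"
proof -
  have s: "summable (\<lambda>d. q d * (if d \<in> N then 0 else u ^ d))"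
    using assms by (intro summable_q_mult) (auto simp: power_le_one)
  then have s: "summable (\<lambda>d. if d \<in> N then 0 else q d * u ^ d)"
    by (rule summable_cong[THEN iffD1, rotated]) auto
  have "(\<lambda>d. if d = 1 then b 1 * u else 0) sums (b 1 * u)"
    using sums_single[of 1 "\<lambda>_. b 1 * u"] by simp
  from sums_add[OF this sums_mult[OF summable_sums[OF s], of "- b 1"]]
  have "(\<lambda>j. if j \<in> N then 0 else b j * u ^ j) sums (b 1 * u + - b 1 * suminf (\<lambda>d. if d \<in> N then 0 else q d * u ^ d))"
  proof (rule sums_cong[THEN iffD1, rotated])
    fix j
    show "(if j = 1 then b 1 * u else 0) + - b 1 * (if j \<in> N then 0 else q j * u ^ j) =
        (if j \<in> N then 0 else b j * u ^ j)"
      using one_notin_N b_eq_q[of j] q_one by (cases "j = 1") auto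
  qed
  then show "B_bar b N u = - b 1 * (suminf (\<lambda>d. if d \<in> N then 0 else q d * u ^ d) - u)"
    and "summable (\<lambda>j. if j \<in> N then 0 else b j * u ^ j)"
    by (auto simp: B_bar_def sums_iff algebra_simps)
qed

lemma B_bar_zero_iff:
  assumes "0 \<le> u" "u \<le> 1"
  shows "B_bar b N u = 0 \<longleftrightarrow> u = suminf (\<lambda>d. if d \<in> N then 0 else q d * u ^ d)"
  using b_one by (auto simp: B_bar_eq(1)[OF assms])

lemma is_min_root_hit: "is_min_root (B_bar b N) (hit 1 0)"
proof -
  have "hit 1 0 \<in> {0..1}" using hit_nonneg hit_le_one by simp
  moreover have "B_bar b N (hit 1 0) = 0"
    using B_bar_zero_iff[OF hit_nonneg hit_le_one] hit_zero_step by blast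
  ultimately show ?thesis
    unfolding is_min_root_def using B_bar_zero_iff hit_zero_le by auto
qed

text \<open>The full series vanishes at 1, and \<open>B_bar\<close> omits positive terms of
  it.\<close>

lemma B_bar_one:
  assumes "N \<noteq> {}"
  shows "B_bar b N 1 < 0"
proof -
  have "(\<lambda>j. if j \<in> N then b j else 0) sums (\<Sum>j\<in>N. b j)"
    using sums_If_finite_set[OF finite_N, of b] by simp
  from sums_diff[OF b_sums_zero this]
  have "(\<lambda>j. if j \<in> N then 0 else b j * 1 ^ j) sums (- (\<Sum>j\<in>N. b j))"
    unfolding diff_0 by (rule sums_cong[THEN iffD1, rotated]) auto
  then have "B_bar b N 1 = - (\<Sum>j\<in>N. b j)" by (simp add: B_bar_def sums_iff)
  moreover have "(\<Sum>j\<in>N. b j) > 0" using assms finite_N b_pos by (intro sum_pos) auto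
  ultimately show ?thesis by simp
qed

lemma hit_zero_less_one: "N \<noteq> {} \<Longrightarrow> hit 1 0 < 1"
  using B_bar_one is_min_root_hit hit_le_one[of 1 0]
  by (cases "hit 1 0 = 1") (auto simp: is_min_root_def)

text \<open>Summability at 1 permits termwise differentiation at \<open>u < 1\<close>; the index-1
  term of the derivative is \<open>b 1\<close>. The inequality adds up the tangent inequalities of
  the powers. The term with index 1 is affine, so equality holds there and the negative sign of
  \<open>b 1\<close> does no harm.\<close>

lemma deriv_B_bar:
  assumes u: "0 \<le> u" "u < 1"
  shows "(\<lambda>j. if j \<in> N \<union> {1} then 0 else b j * (real j * u ^ (j - 1))) sums (deriv (B_bar b N) u - b 1)"
    and "B_bar b N 1 \<ge> B_bar b N u + (1 - u) * deriv (B_bar b N) u"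
proof -
  define c where "c j = (if j \<in> N then 0 else b j)" for j
  have B: "B_bar b N = (\<lambda>u. suminf (\<lambda>j. c j * u ^ j))"
    unfolding B_bar_def c_def by (intro ext suminf_cong) auto
  have sc: "summable (\<lambda>j. c j * 1 ^ j)" using summable_coeff by (simp add: c_def)
  have "((\<lambda>u. suminf (\<lambda>j. c j * u ^ j)) has_field_derivative (suminf (\<lambda>j. diffs c j * u ^ j))) (at u)"
    by (rule termdiffs_strong[OF sc]) (use u in auto)
  then have D: "deriv (B_bar b N) u = suminf (\<lambda>j. diffs c j * u ^ j)"
    unfolding B by (rule DERIV_imp_deriv)
  have "summable (\<lambda>j. diffs c j * u ^ j)"
    by (rule termdiff_converges[where K = 1])
      (use u in \<open>auto intro!: powser_inside[OF sc]\<close>)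
  from diffs_equiv[OF this] have e: "(\<lambda>j. real j * c j * u ^ (j - 1)) sums deriv (B_bar b N) u"
    by (simp add: D)
  have "(\<lambda>j. if j = 1 then b 1 else 0) sums b 1"
    using sums_single[of 1 b] by (rule sums_cong[THEN iffD1, rotated]) simp
  from sums_diff[OF e this]
  show "(\<lambda>j. if j \<in> N \<union> {1} then 0 else b j * (real j * u ^ (j - 1))) sums (deriv (B_bar b N) u - b 1)"
    by (rule sums_cong[THEN iffD1, rotated]) (use one_notin_N in \<open>auto simp: c_def\<close>)
  have s: "(\<lambda>j. c j * u ^ j) sums B_bar b N u"
  proof -
    have "(\<lambda>j. c j * u ^ j) = (\<lambda>j. if j \<in> N then 0 else b j * u ^ j)" by (auto simp: c_def)
    then show ?thesis using B_bar_eq(2)[of u] u unfolding B by (simp add: summable_sums)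
  qed
  have s1: "(\<lambda>j. c j) sums B_bar b N 1"
    using sc unfolding B by (simp add: summable_sums)
  show "B_bar b N 1 \<ge> B_bar b N u + (1 - u) * deriv (B_bar b N) u"
  proof (rule sums_le[OF _ sums_add[OF s sums_mult[OF e, of "1 - u"]] s1])
    fix j
    show "c j * u ^ j + (1 - u) * (real j * c j * u ^ (j - 1)) \<le> c j"
    proof (cases "j = 1")
      case False
      then have "0 \<le> c j" using b_nonneg by (simp add: c_def)
      from mult_left_mono[OF bernoulli_tangent[of u j] this] u show ?thesis
        by (simp add: algebra_simps)
    qed (simp add: algebra_simps)
  qed
qed

text \<open>The tangent at the root lies below the negative value at 1, and the root is less than 1,
  so its slope is negative. This makes the division in the recursion legitimate.\<close>

lemma deriv_B_bar_neg:
  assumes "N \<noteq> {}"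
  shows "deriv (B_bar b N) (hit 1 0) < 0"
proof -
  have "B_bar b N (hit 1 0) = 0" using is_min_root_hit by (simp add: is_min_root_def)
  then have "(1 - hit 1 0) * deriv (B_bar b N) (hit 1 0) < 0"
    using deriv_B_bar(2)[OF hit_nonneg hit_zero_less_one[OF assms]] B_bar_one[OF assms] by linarith
  then show ?thesis using hit_zero_less_one[OF assms] by (simp add: mult_less_0_iff)
qed

lemma crossing_recursion_summed_hit: "crossing_recursion_summed b N (hit 1)"
  unfolding crossing_recursion_summed_def
proof (intro conjI ballI is_min_root_hit)
  fix l k assume l: "l \<in> vecs N" and k: "k \<in> N"
  define l' where "l' = l + unit_vec k"
  define u where "u = hit 1 0"
  have N: "N \<noteq> {}" using k by auto
  have D: "deriv (B_bar b N) u < 0" unfolding u_def by (rule deriv_B_bar_neg[OF N])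
  have u: "0 \<le> u" "u < 1" unfolding u_def using hit_nonneg hit_zero_less_one[OF N] by auto
  have tl: "total l' = Suc (total l)" by (simp add: l'_def total_add)
  have keys_subset: "Poly_Mapping.keys l' \<subseteq> N" using l k by (auto simp: l'_def vecs_def keys_add_nat)
  define S where "S = (\<Sum>m\<in>Poly_Mapping.keys l'. b m * conv_power (hit 1) m (l' - unit_vec m))"
  define bc where "bc = (\<lambda>j. if j \<in> N \<union> {1} then 0 else b j * bounded_conv_power (hit 1) (total l) j l')"
  \<comment> \<open>Since \<open>hit j\<close> is the \<open>j\<close>-th convolution power, its
    value at \<open>l'\<close> contains \<open>hit 1 l'\<close> with the derivative of
    \<open>u ^ j\<close> as coefficient.\<close>
  have split: "(if j \<in> N \<union> {1} then 0 else b j * hit j l')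
      = bc j + (if j \<in> N \<union> {1} then 0 else b j * (real j * u ^ (j - 1))) * hit 1 l'" for j
    using conv_power_split[OF tl, of "hit 1" j] unfolding conv_power_hit
    by (simp add: bc_def u_def algebra_simps)
  have "(\<lambda>d. q d * mult_var N d (hit d) l') sums hit 1 l'"
    using hit_step[of 1 l'] summable_q_mult[of "\<lambda>d. mult_var N d (hit d) l'"] mult_var_hit_bounds
    by (simp add: sums_iff)
  from sums_mult[OF this, of "- b 1"]
  have "(\<lambda>d. - b 1 * (q d * mult_var N d (hit d) l')) sums (- b 1 * hit 1 l')" .
  moreover have "(\<lambda>d. if d \<in> N then b d * mult_var N d (hit d) l' else 0) sums
      (\<Sum>d\<in>N. b d * mult_var N d (hit d) l')"
    by (rule sums_If_finite_set[OF finite_N])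
  \<comment> \<open>A marked first step is possible only if its coordinate in \<open>l'\<close> is
    nonzero. This is the origin of the sum over the keys in the last term.\<close>
  moreover have "(\<Sum>d\<in>N. b d * mult_var N d (hit d) l') = S"
    unfolding S_def conv_power_hit using keys_subset finite_N
    by (intro sum.mono_neutral_cong_right) (auto simp: mult_var_def in_keys_iff subset_eq)
  ultimately have "(\<lambda>d. - b 1 * (q d * mult_var N d (hit d) l') - (if d \<in> N then b d * mult_var N d (hit d) l' else 0))
     sums (- b 1 * hit 1 l' - S)"
    using sums_diff by fastforce
  then have "(\<lambda>j. if j \<in> N \<union> {1} then 0 else b j * hit j l') sums (- b 1 * hit 1 l' - S)"
  proof (rule sums_cong[THEN iffD1, rotated])
    fix j
    show "- b 1 * (q j * mult_var N j (hit j) l') - (if j \<in> N then b j * mult_var N j (hit j) l' else 0) =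
        (if j \<in> N \<union> {1} then 0 else b j * hit j l')"
      using one_notin_N b_eq_q[of j] q_one by (cases "j = 1") (auto simp: mult_var_def)
  qed
  \<comment> \<open>The \<open>b 1\<close> split off from the derivative cancels against
    \<open>- b 1 * hit 1 l'\<close>, so that exactly the derivative remains as factor of
    \<open>hit 1 l'\<close>.\<close>
  from sums_diff[OF this sums_mult2[OF deriv_B_bar(1)[OF u], of "hit 1 l'"]]
  have "bc sums (- b 1 * hit 1 l' - S - (deriv (B_bar b N) u - b 1) * hit 1 l')"
    unfolding split by simp
  then have "suminf bc = - S - deriv (B_bar b N) u * hit 1 l'"
    by (simp add: sums_iff algebra_simps)
  then have "hit 1 l' = - (suminf bc + S) / deriv (B_bar b N) u"
    using D by (simp add: field_simps)
  then show "hit 1 (l + unit_vec k) =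
       - (suminf (\<lambda>j. if j \<in> N \<union> {1} then 0 else b j * bounded_conv_power (hit 1) (total l) j (l + unit_vec k)) +
          (\<Sum>m\<in>Poly_Mapping.keys (l + unit_vec k). b m * conv_power (hit 1) m (l + unit_vec k - unit_vec m))) /
       deriv (B_bar b N) (hit 1 0)"
    by (simp only: bc_def S_def l'_def u_def)
qed

end

section \<open>The recursion with a single last term\<close>

lemma B_bar_empty: "B_bar b {} = B_gf b"
  by (simp add: B_bar_def B_gf_def fun_eq_iff)

text \<open>Only decompositions into zero vectors could contribute, and these do not add up to a
  nonzero \<open>l\<close>.\<close>

lemma bounded_conv_power_zero:
  assumes "l \<noteq> 0" "\<And>a. a \<noteq> 0 \<Longrightarrow> total a \<le> n \<Longrightarrow> a \<in> vecs N \<Longrightarrow> r a = 0" "l \<in> vecs N"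
    and "r 0 = 0 \<or> n = 0"
  shows "bounded_conv_power r n j l = 0"
  unfolding bounded_conv_power_eq using assms(1,3)
proof (induction j arbitrary: l)
  case (Suc j)
  have "truncate n r a * conv_power (truncate n r) j c = 0" if "a + c = l" for a c
  proof (cases "a = 0")
    case True
    then show ?thesis using Suc that by simp
  next
    case False
    have "a \<in> vecs N" using that[symmetric] Suc.prems by (simp add: vecs_add_iff)
    then show ?thesis using False assms(2)[of a] by (simp add: truncate_def)
  qed
  then show ?case by (auto simp: conv_power_Suc conv_def intro!: sum.neutral)
qed (simp add: conv_power_0)

lemma conv_power_below:
  assumes "r 0 = 0" "total l < j"
  shows "conv_power r j l = 0"
  using assms(2)
proof (induction j arbitrary: l)
  case (Suc j)
  have "r a * conv_power r j c = 0" if "a + c = l" for a c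
  proof (cases "a = 0")
    case False
    then have "total c < j" using Suc.prems that total_add[of a c] total_eq_0_iff[of a] by simp
    then show ?thesis using Suc.IH by simp
  qed (use assms in simp)
  then show ?case by (auto simp: conv_power_Suc conv_def intro!: sum.neutral)
qed simp

text \<open>For a series without constant term the \<open>j\<close>-th power starts in degree
  \<open>j\<close>. In that degree every summand has total 1, and only multiples of
  \<open>unit_vec k\<close> can occur, so all summands equal \<open>unit_vec k\<close>.\<close>

lemma conv_power_diagonal:
  assumes "r 0 = 0"
  shows "conv_power r j (Poly_Mapping.single k j) = r (unit_vec k) ^ j"
proof (induction j)
  case (Suc j)
  let ?l = "Poly_Mapping.single k (Suc j)" and ?c = "Poly_Mapping.single k j"
  have e: "unit_vec k + ?c = ?l" by (simp add: single_add[symmetric])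
  have zero: "r a * conv_power r j c = 0" if ac: "a + c = ?l" "(a, c) \<noteq> (unit_vec k, ?c)" for a c
  proof (cases "a = 0 \<or> total c < j")
    case True
    then show ?thesis using assms conv_power_below[where r = r, OF assms] by auto
  next
    case False
    moreover have "total a + total c = Suc j"
      unfolding total_add[symmetric] ac(1) by (simp add: total_def)
    ultimately have "total a = 1" using total_eq_0_iff[of a] by simp
    have "Poly_Mapping.lookup a m = 0" if "m \<noteq> k" for m
    proof -
      have "Poly_Mapping.lookup (a + c) m = 0" unfolding ac(1) using that by (simp add: lookup_single)
      then show ?thesis by (simp add: lookup_add)
    qed
    then have "Poly_Mapping.keys a \<subseteq> {k}" by (auto simp: in_keys_iff)
    then have "Poly_Mapping.lookup a k = 1" using \<open>total a = 1\<close> total_eq_sum[of "{k}" a] by simp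
    then have "a = unit_vec k"
      using \<open>\<And>m. m \<noteq> k \<Longrightarrow> Poly_Mapping.lookup a m = 0\<close> by (intro poly_mapping_eqI) (auto simp: lookup_single when_def)
    then have "c = ?c" using ac(1) e by (metis add_left_cancel)
    then show ?thesis using ac(2) \<open>a = unit_vec k\<close> by simp
  qed
  have "(case p of (a, c) \<Rightarrow> r a * conv_power r j c) = 0" if "p \<in> splits ?l - {(unit_vec k, ?c)}" for p
    using that zero[of "fst p" "snd p"] by (cases p) simp
  then have "conv_power r (Suc j) ?l = (\<Sum>(a, c)\<in>{(unit_vec k, ?c)}. r a * conv_power r j c)"
    unfolding conv_power_Suc conv_def
    by (intro sum.mono_neutral_right ballI) (use e in simp_all)
  then show ?case using Suc by simp
qed (simp add: conv_power_0)

context branching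
begin

lemma crossing_recursion_imp_summed:
  assumes r: "crossing_recursion b N r" and N: "\<And>k m. k \<in> N \<Longrightarrow> m \<in> N \<Longrightarrow> k = m"
  shows "crossing_recursion_summed b N r"
proof -
  have "Poly_Mapping.keys (l + unit_vec k) = {k}" if "l \<in> vecs N" "k \<in> N" for l k
    using N that unfolding keys_add_nat by (auto simp: vecs_def)
  then show ?thesis
    using r unfolding crossing_recursion_def crossing_recursion_summed_def by simp
qed

text \<open>With \<open>b 0 = 0\<close> the minimal root is 0 and \<open>0 \<notin> N\<close>, so
  each term of the recursion contains a factor at a vector of smaller total. This is the case in
  which extinction has probability 0.\<close>

lemma crossing_recursion_vanishes:
  assumes r: "crossing_recursion b N r" and b0: "b 0 = 0" and "l \<in> vecs N"
  shows "r l = 0"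
  using assms(3)
proof (induction "total l" arbitrary: l rule: less_induct)
  case less
  have "0 \<notin> N" using b_pos b0 by force
  have "B_bar b N 0 = 0"
    unfolding B_bar_def using b0 by (simp add: power_0_left if_distrib cong: if_cong)
  then have r0: "r 0 = 0"
    using r by (force simp: crossing_recursion_def is_min_root_def)
  show ?case
  proof (cases "l = 0")
    case False
    then obtain l' k where l: "l' \<in> vecs N" "k \<in> N" "l = l' + unit_vec k"
      using vecs_split less.prems by metis
    have tl: "total l = Suc (total l')" by (simp add: l total_add)
    have z: "r a = 0" if "total a \<le> total l'" "a \<in> vecs N" for a
      using less.hyps that tl by simp
    have bc: "bounded_conv_power r (total l') j l = 0" for j
      by (rule bounded_conv_power_zero[where N = N]) (use z r0 False less.prems in auto)
    \<comment> \<open>Every part of \<open>l'\<close> has smaller total than \<open>l\<close>. The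
      resulting power of the zero family is 0 only because \<open>k \<ge> 1\<close>.\<close>
    have "conv_power r k l' = conv_power (\<lambda>_. 0) k l'"
      by (rule conv_power_cong) (use z l(1) in \<open>auto simp: total_add vecs_add_iff\<close>)
    also have "\<dots> = 0" using \<open>k \<in> N\<close> \<open>0 \<notin> N\<close> by (cases k) (auto simp: conv_power_Suc conv_zero_left)
    finally have "conv_power r k l' = 0" .
    moreover have "r l = - (suminf (\<lambda>j. if j \<in> N \<union> {1} then 0 else b j * bounded_conv_power r (total l') j l)
             + b k * conv_power r k l') / deriv (B_bar b N) (r 0)"
      using r l unfolding crossing_recursion_def by blast
    ultimately show ?thesis by (simp add: bc cong: if_cong)
  qed (use r0 in simp)
qed

text \<open>
  Two indices \<open>k\<close> and \<open>m\<close> for the same vector give contradictory equations: the vector is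
  \<open>unit_vec k + unit_vec m\<close> if \<open>r 0 > 0\<close>. If \<open>r 0 = 0\<close>, then \<open>0 \<in> N\<close>, and the vector is \<open>i\<close> times
  \<open>unit_vec 0\<close> plus \<open>unit_vec i\<close> for another \<open>i \<in> N\<close>.
\<close>

lemma crossing_recursion_contradictory:
  assumes r: "crossing_recursion b N r" and b0: "b 0 \<noteq> 0" and km: "k \<in> N" "m \<in> N" "k \<noteq> m"
  shows False
proof -
  define D where "D = deriv (B_bar b N) (r 0)"
  have "r 0 = hit 1 0"
    using r is_min_root_hit is_min_root_unique by (auto simp: crossing_recursion_def)
  then have D: "D < 0" and r0: "0 \<le> r 0"
    unfolding D_def using deriv_B_bar_neg hit_nonneg km by auto
  define S where "S l n = suminf (\<lambda>j. if j \<in> N \<union> {1} then 0 else b j * bounded_conv_power r n j l)" for l n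
  have rec: "r (l + unit_vec i) = - (S (l + unit_vec i) (total l) + b i * conv_power r i l) / D"
    if "l \<in> vecs N" "i \<in> N" for l i
    using r that unfolding crossing_recursion_def S_def D_def by blast
  \<comment> \<open>Both vectors have the same total, so the bounded terms of the two equations
    agree and only the last terms are left to compare.\<close>
  have compare: "b i * conv_power r i l = b i' * conv_power r i' l'"
    if "l \<in> vecs N" "i \<in> N" "l' \<in> vecs N" "i' \<in> N" "l + unit_vec i = l' + unit_vec i'" for l i l' i'
  proof -
    have "total l + 1 = total l' + 1"
      using arg_cong[OF that(5), of total] by (simp add: total_add)
    then show ?thesis
      using rec[OF that(1,2)] rec[OF that(3,4)] that(5) D by simp
  qed
  have unit: "unit_vec i \<in> vecs N" "0 \<in> vecs N" if "i \<in> N" for i using that by (auto simp: vecs_def)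
  have bc: "bounded_conv_power r 0 j (unit_vec i) = 0" if "i \<in> N" for i j
    by (rule bounded_conv_power_zero[where N = N]) (use that unit in \<open>auto simp: total_eq_0_iff unit_vec_neq_zero\<close>)
  have r1: "r (unit_vec i) = - b i * r 0 ^ i / D" if "i \<in> N" for i
    using rec[OF unit(2)[OF that] that] bc[OF that] by (simp add: S_def conv_power_at_zero cong: if_cong)
  show False
  proof (cases "r 0 = 0")
    case False
    have cp: "conv_power r i (unit_vec i') = real i * r 0 ^ (i - 1) * r (unit_vec i')" if "i' \<in> N" for i i'
      using conv_power_split[of "unit_vec i'" 0 r i] bc[OF that] by simp
    have "b k * conv_power r k (unit_vec m) = b m * conv_power r m (unit_vec k)"
      by (rule compare) (use km unit in \<open>auto simp: add.commute\<close>)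
    \<comment> \<open>The extra factor \<open>r 0\<close> raises the truncated exponents to
      \<open>k\<close> and \<open>m\<close>. Both sides then differ only in the factors
      \<open>real k\<close> and \<open>real m\<close>.\<close>
    then have eq: "r 0 * (b k * (real k * r 0 ^ (k - 1) * (b m * r 0 ^ m))) = r 0 * (b m * (real m * r 0 ^ (m - 1) * (b k * r 0 ^ k)))"
      unfolding cp[OF km(1)] cp[OF km(2)] r1[OF km(1)] r1[OF km(2)]
      using D by (simp add: divide_simps)
    have pow: "r 0 * (b i * (real i * r 0 ^ (i - 1) * (b i' * r 0 ^ i'))) = real i * (b i * b i' * r 0 ^ i * r 0 ^ i')" for i i'
      by (cases i) auto
    have "real k * (b k * b m * r 0 ^ k * r 0 ^ m) = real m * (b m * b k * r 0 ^ m * r 0 ^ k)"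
      by (rule trans[OF sym[OF pow] trans[OF eq pow]])
    then have "real k * (b k * b m * r 0 ^ k * r 0 ^ m) = real m * (b k * b m * r 0 ^ k * r 0 ^ m)"
      by (simp only: mult_ac)
    moreover have "b k * b m * r 0 ^ k * r 0 ^ m \<noteq> 0" using False b_pos[OF km(1)] b_pos[OF km(2)] by simp
    ultimately show False using km by simp
  next
    case True
    have "B_bar b N 0 = (if 0 \<in> N then 0 else b 0)"
    proof -
      have "(\<lambda>j. if j \<in> N then 0 else b j * 0 ^ j) = (\<lambda>j. if j = 0 then if 0 \<in> N then 0 else b 0 else 0)"
        by auto
      then show ?thesis
        using sums_single[of 0 "\<lambda>_. if 0 \<in> N then 0 else b 0"] by (simp add: B_bar_def sums_iff)
    qed
    moreover have "B_bar b N 0 = 0" using r True by (simp add: crossing_recursion_def is_min_root_def)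
    ultimately have "0 \<in> N" using b0 by (simp split: if_splits)
    obtain i where i: "i \<in> N" "i \<noteq> 0" using km by metis
    let ?l = "Poly_Mapping.single 0 i :: nat \<Rightarrow>\<^sub>0 nat" and ?l' = "Poly_Mapping.single 0 (i - 1) + unit_vec i"
    have vecs: "Poly_Mapping.single 0 n \<in> vecs N" for n using \<open>0 \<in> N\<close> by (auto simp: vecs_def)
    have "?l' + unit_vec 0 = Poly_Mapping.single 0 (i - 1 + 1) + unit_vec i"
      unfolding single_add by (simp add: ac_simps)
    \<comment> \<open>The right-hand side is a zeroth power at a nonzero vector, hence 0, while the
      left-hand side is \<open>b i\<close> times a power of \<open>r (unit_vec 0)\<close>.\<close>
    then have "b i * conv_power r i ?l = b 0 * conv_power r 0 ?l'"
      using i \<open>0 \<in> N\<close> vecs unit by (intro compare) (auto simp: vecs_add_iff)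
    moreover have "?l' \<noteq> 0"
      using total_eq_0_iff[of ?l'] by (auto simp: total_add)
    ultimately have "b i * r (unit_vec 0) ^ i = 0"
      unfolding conv_power_diagonal[where r = r, OF True] by (simp add: conv_power_0)
    \<comment> \<open>Although \<open>r 0 = 0\<close>, the factor \<open>r 0 ^ 0\<close> in
      \<open>r1\<close> is 1.\<close>
    moreover have "r (unit_vec 0) \<noteq> 0" using r1[OF \<open>0 \<in> N\<close>] b0 D by simp
    ultimately show False using b_pos[OF i(1)] by simp
  qed
qed

end

section \<open>Extinction and crossing numbers\<close>

lemma jump_path_before:
  "jump_path x s ws T \<Longrightarrow> u \<in> {s..<T} \<Longrightarrow> x u \<in> set (butlast (x s # ws))"
proof (induction rule: jump_path_induct)
  case (Cons s t j ws T)
  show ?case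
  proof (cases "u < t")
    case True
    then have "x u = x s" using bspec[OF Cons.hyps(2), of u] Cons.prems by simp
    then show ?thesis by simp
  next
    case False
    then have "x u \<in> set (butlast (j # ws))" using Cons.IH Cons.prems Cons.hyps(3) by simp
    then show ?thesis by simp
  qed
qed simp

lemma jump_path_leaving:
  "jump_path x s ws T \<Longrightarrow> 0 \<notin> set (butlast (x s # ws)) \<Longrightarrow> leaving (\<lambda>i. 0 < i) (x s) ws"
proof (induction rule: jump_path_induct)
  case (Cons s t j ws T)
  have "0 < x s" "0 \<notin> set (butlast (j # ws))" using Cons.prems by auto
  then show ?case using Cons.IH Cons.hyps(3,4) by simp
qed simp

text \<open>The start counts as visited, so the empty word qualifies exactly for the start
  0.\<close>

definition hitting_word :: "nat \<Rightarrow> nat list \<Rightarrow> bool" where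
  "hitting_word i ws \<longleftrightarrow> last (i # ws) = 0 \<and> 0 \<notin> set (butlast (i # ws))"

lemma extinction_time_jump_path:
  assumes "jump_path x 0 ws T" "hitting_word (x 0) ws"
  shows "extinction_time x = ereal T"
  unfolding extinction_time_def
proof (rule antisym)
  have "x T = 0" "0 \<le> T"
    using jump_path_last[OF assms(1)] jump_path_ge[OF assms(1)] assms(2) by (auto simp: hitting_word_def)
  then show "(INF t\<in>{t. 0 \<le> t \<and> x t = 0}. ereal t) \<le> ereal T"
    by (intro INF_lower) simp
  show "ereal T \<le> (INF t\<in>{t. 0 \<le> t \<and> x t = 0}. ereal t)"
  proof (rule INF_greatest)
    fix t assume t: "t \<in> {t. 0 \<le> t \<and> x t = 0}"
    show "ereal T \<le> ereal t"
    proof (rule ccontr)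
      assume "\<not> ereal T \<le> ereal t"
      then have "x t \<in> set (butlast (x 0 # ws))"
        using t by (intro jump_path_before[OF assms(1)]) simp
      then show False using t assms(2) by (auto simp: hitting_word_def)
    qed
  qed
qed

text \<open>Finite extinction time yields some time at which the path is 0. The word read up to that
  time contains 0 and is cut at its first occurrence.\<close>

lemma exists_hitting_word:
  fixes x :: "real \<Rightarrow> nat"
  assumes rc: "\<And>t. 0 \<le> t \<Longrightarrow> continuous (at_right t) x"
    and fin: "\<And>t. finite (jump_times x \<inter> {..t})"
    and "extinction_time x < \<infinity>"
  shows "\<exists>ws T. jump_path x 0 ws T \<and> hitting_word (x 0) ws"
proof -
  have "{t. 0 \<le> t \<and> x t = 0} \<noteq> {}"
  proof
    assume "{t. 0 \<le> t \<and> x t = 0} = {}"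
    then have "extinction_time x = \<infinity>" by (simp only: extinction_time_def) (simp add: top_ereal_def)
    then show False using assms(3) by simp
  qed
  then obtain t where t: "0 \<le> t" "x t = 0" by auto
  obtain ws T where ws: "jump_path x 0 ws T" "T \<le> t" "\<forall>u\<in>{T..t}. x u = x T"
    using exists_jump_path[OF rc fin order_refl t(1)] by blast
  have "x t = x T" using bspec[OF ws(3), of t] ws(2) by simp
  then have "last (x 0 # ws) = 0" using jump_path_last[OF ws(1)] t(2) by simp
  then have "0 \<in> set (x 0 # ws)" by (metis last_in_set list.distinct(1))
  then obtain us vs where us: "x 0 # ws = us @ 0 # vs" "0 \<notin> set us"
    by (metis split_list_first)
  show ?thesis
  proof (cases us)
    case Nil
    then show ?thesis using us by (intro exI[of _ "[]"] exI[of _ 0]) (simp add: hitting_word_def)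
  next
    case (Cons i us')
    then have "ws = (us' @ [0]) @ vs" "i = x 0" using us by auto
    then obtain T' where "jump_path x 0 (us' @ [0]) T'"
      using jump_path_append[of x 0 "us' @ [0]" vs T] ws(1) by blast
    moreover have "hitting_word (x 0) (us' @ [0])"
      using us Cons \<open>i = x 0\<close> by (auto simp: hitting_word_def butlast_append)
    ultimately show ?thesis by blast
  qed
qed

lemma crossing_times_pos: "s \<in> crossing_times k x \<Longrightarrow> 0 < s"
  by (simp add: crossing_times_def jump_times_def)

lemma crossing_number_jump_path:
  assumes "jump_path x 0 ws T" "hitting_word (x 0) ws"
  shows "crossing_number k x (extinction_time x) = crossing_count k (x 0) ws"
proof -
  have "{s \<in> crossing_times k x. ereal s \<le> ereal T} = crossing_times k x \<inter> {0<..T}"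
    using crossing_times_pos by auto
  then show ?thesis
    using jump_path_crossing_count[OF assms(1)]
    by (simp add: crossing_number_eq extinction_time_jump_path[OF assms])
qed

text \<open>The left side ranges over countably many words and is thus suited to measurability. The
  right side speaks of the whole path, without a time bound and without assuming finitely many
  crossings.\<close>

lemma crossing_count_ge_iff:
  fixes x :: "real \<Rightarrow> nat"
  assumes rc: "\<And>t. 0 \<le> t \<Longrightarrow> continuous (at_right t) x"
    and fin: "\<And>t. finite (jump_times x \<inter> {..t})"
  shows "(\<exists>ws T. jump_path x 0 ws T \<and> m \<le> crossing_count k (x 0) ws) \<longleftrightarrow>
    (\<exists>F. F \<subseteq> crossing_times k x \<and> finite F \<and> card F = m)"
proof
  assume "\<exists>ws T. jump_path x 0 ws T \<and> m \<le> crossing_count k (x 0) ws"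
  then obtain ws T where "jump_path x 0 ws T" "m \<le> crossing_count k (x 0) ws" by blast
  then have "m \<le> card (crossing_times k x \<inter> {0<..T})"
    using jump_path_crossing_count[of x 0 ws T k] by simp
  then obtain F where "F \<subseteq> crossing_times k x \<inter> {0<..T}" "card F = m" "finite F"
    by (rule obtain_subset_with_card_n)
  then show "\<exists>F. F \<subseteq> crossing_times k x \<and> finite F \<and> card F = m" by blast
next
  assume "\<exists>F. F \<subseteq> crossing_times k x \<and> finite F \<and> card F = m"
  then obtain F where F: "F \<subseteq> crossing_times k x" "finite F" "card F = m" by blast
  \<comment> \<open>Strictly later than all chosen crossings, so that none of them lies in the final
    interval of constancy; the inserted 0 covers an empty \<open>F\<close> and makes
    \<open>t\<close> nonnegative.\<close>
  define t where "t = Max (insert 0 F) + 1"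
  have Ft: "s < t" if "s \<in> insert 0 F" for s
  proof -
    have "s \<le> Max (insert 0 F)" using F(2) that by (intro Max_ge) simp_all
    then show ?thesis unfolding t_def by linarith
  qed
  then have "0 \<le> t" by force
  obtain ws T where ws: "jump_path x 0 ws T" "T \<le> t" "\<forall>u\<in>{T..t}. x u = x T"
    using exists_jump_path[OF rc fin order_refl \<open>0 \<le> t\<close>] by blast
  have "s \<le> T" if "s \<in> F" for s
  proof (rule ccontr)
    assume "\<not> s \<le> T"
    then have "s \<in> {T<..<t}" using Ft that by simp
    moreover have "\<forall>u\<in>{T..<t}. x u = x T" by (intro ballI bspec[OF ws(3)]) simp
    ultimately have "s \<notin> jump_times x" using jump_times_constant by blast
    then show False using F(1) that by (auto simp: crossing_times_def)
  qed
  then have "F \<subseteq> crossing_times k x \<inter> {0<..T}"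
    using F(1) crossing_times_pos by (auto simp: subset_eq)
  then have "m \<le> crossing_count k (x 0) ws"
    using jump_path_crossing_count[OF ws(1), of k] F(3) card_mono by fastforce
  then show "\<exists>ws T. jump_path x 0 ws T \<and> m \<le> crossing_count k (x 0) ws" using ws(1) by blast
qed

text \<open>The second alternative accounts for the convention that an infinite set has
  \<open>card\<close> 0.\<close>

lemma card_eq_iff_subsets:
  "card C = m \<longleftrightarrow> ((\<exists>F. F \<subseteq> C \<and> finite F \<and> card F = m) \<and> \<not> (\<exists>F. F \<subseteq> C \<and> finite F \<and> card F = Suc m))
    \<or> (m = 0 \<and> (\<forall>n. \<exists>F. F \<subseteq> C \<and> finite F \<and> card F = n))"
proof (cases "finite C")
  case True
  have subsets: "(\<exists>F. F \<subseteq> C \<and> finite F \<and> card F = n) \<longleftrightarrow> n \<le> card C" for n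
    using True by (meson card_mono obtain_subset_with_card_n)
  have "\<not> (\<forall>n. n \<le> card C)" using Suc_n_not_le_n by blast
  then show ?thesis unfolding subsets by auto
next
  case False
  then have "\<exists>F. F \<subseteq> C \<and> finite F \<and> card F = n" for n
    using infinite_arbitrarily_large[of C n] by blast
  then show ?thesis using False by auto
qed

section \<open>Words encoded by their steps\<close>

fun states :: "nat \<Rightarrow> nat list \<Rightarrow> nat list" where
  "states i [] = []"
| "states i (d # ds) = (i + d - 1) # states (i + d - 1) ds"

fun endpoint :: "nat \<Rightarrow> nat list \<Rightarrow> nat" where
  "endpoint i [] = i"
| "endpoint i (d # ds) = endpoint (i + d - 1) ds"

text \<open>A step with \<open>d = 1\<close> is no jump, and 0 is never left. The condition
  \<open>0 < i\<close> also makes the truncated subtraction in \<open>i + d - 1\<close>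
  harmless.\<close>

fun admissible :: "nat \<Rightarrow> nat list \<Rightarrow> bool" where
  "admissible i [] \<longleftrightarrow> True"
| "admissible i (d # ds) \<longleftrightarrow> 0 < i \<and> d \<noteq> 1 \<and> admissible (i + d - 1) ds"

fun step_counts :: "nat set \<Rightarrow> nat list \<Rightarrow> (nat \<Rightarrow>\<^sub>0 nat)" where
  "step_counts N [] = 0"
| "step_counts N (d # ds) = (if d \<in> N then unit_vec d else 0) + step_counts N ds"

lemma states_append: "states i (ds @ es) = states i ds @ states (endpoint i ds) es"
  by (induction ds arbitrary: i) auto

lemma endpoint_append: "endpoint i (ds @ es) = endpoint (endpoint i ds) es"
  by (induction ds arbitrary: i) auto

lemma admissible_append:
  "admissible i (ds @ es) \<longleftrightarrow> admissible i ds \<and> admissible (endpoint i ds) es"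
  by (induction ds arbitrary: i) auto

lemma admissible_zero: "admissible 0 ds \<longleftrightarrow> ds = []"
  by (cases ds) auto

lemma last_states: "last (i # states i ds) = endpoint i ds"
  by (induction ds arbitrary: i) auto

lemma hitting_word_states: "admissible i ds \<Longrightarrow> endpoint i ds = 0 \<Longrightarrow> hitting_word i (states i ds)"
proof -
  have "admissible i ds \<Longrightarrow> 0 \<notin> set (butlast (i # states i ds))"
    by (induction ds arbitrary: i) auto
  then show "admissible i ds \<Longrightarrow> endpoint i ds = 0 \<Longrightarrow> hitting_word i (states i ds)"
    unfolding hitting_word_def last_states by blast
qed

lemma crossing_count_states: "admissible i ds \<Longrightarrow> crossing_count k i (states i ds) = count_list ds k"
  by (induction ds arbitrary: i) auto

lemma lookup_step_counts: "k \<in> N \<Longrightarrow> Poly_Mapping.lookup (step_counts N ds) k = count_list ds k"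
  by (induction ds) (auto simp: lookup_add lookup_single when_def)

lemma step_counts_vecs: "step_counts N ds \<in> vecs N"
proof (induction ds)
  case (Cons d ds)
  then show ?case by (auto simp: vecs_add_iff) (auto simp: vecs_def)
qed (simp add: vecs_def)

lemma step_counts_Cons_iff:
  "step_counts N (d # ds) = l \<longleftrightarrow>
    (if d \<in> N then Poly_Mapping.lookup l d \<noteq> 0 \<and> step_counts N ds = l - unit_vec d else step_counts N ds = l)"
proof (cases "d \<in> N")
  case True
  have "unit_vec d + c = l \<longleftrightarrow> Poly_Mapping.lookup l d \<noteq> 0 \<and> c = l - unit_vec d" for c
    using minus_unit_vec[of l d] by (auto simp: lookup_add add.commute)
  then show ?thesis using True by simp
qed simp

lemma vecs_eqI:
  assumes "l \<in> vecs N" "l' \<in> vecs N" "\<And>k. k \<in> N \<Longrightarrow> Poly_Mapping.lookup l k = Poly_Mapping.lookup l' k"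
  shows "l = l'"
proof (rule poly_mapping_eqI)
  fix k
  show "Poly_Mapping.lookup l k = Poly_Mapping.lookup l' k"
  proof (cases "k \<in> N")
    case False
    then have "k \<notin> Poly_Mapping.keys l" "k \<notin> Poly_Mapping.keys l'" using assms(1,2) by (auto simp: vecs_def)
    then show ?thesis by (simp add: in_keys_iff)
  qed (use assms(3) in simp)
qed

section \<open>Probabilities of the crossing vectors\<close>

locale branching_process = regular_ctmc M "weighted_branching_Q b w" p X + branching b N
  for M :: "'a measure" and b w :: "nat \<Rightarrow> real" and p X N +
  assumes w_pos: "\<And>i. 1 \<le> i \<Longrightarrow> 0 < w i"
    and start: "AE \<omega> in M. X 0 \<omega> = 1"
begin

abbreviation Q :: "nat \<Rightarrow> nat \<Rightarrow> real" where "Q \<equiv> weighted_branching_Q b w"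

lemma Q_diagonal: "0 < i \<Longrightarrow> Q i i < 0"
  using w_pos[of i] b_one by (simp add: weighted_branching_Q_def mult_less_0_iff)

lemma Q_ratio: "0 < i \<Longrightarrow> d \<noteq> 1 \<Longrightarrow> Q i (i + d - 1) / - Q i i = q d"
  using w_pos[of i] b_one by (simp add: weighted_branching_Q_def q_def)

lemma embedded_prob_states: "admissible i ds \<Longrightarrow> embedded_prob Q i (states i ds) = prod_list (map q ds)"
  using Q_ratio by (induction ds arbitrary: i) auto

lemma leaving_states: "admissible i ds \<Longrightarrow> leaving (\<lambda>i. Q i i < 0) i (states i ds)"
  using Q_diagonal by (induction ds arbitrary: i) auto

lemma prob_start: "prob {\<omega> \<in> space M. X 0 \<omega> = 1} = 1"
proof -
  have [measurable]: "X 0 \<in> M \<rightarrow>\<^sub>M count_space UNIV" by (rule measurable_X) simp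
  have "{\<omega> \<in> space M. X 0 \<omega> = 1} \<in> events" by measurable
  then show ?thesis using start by (simp add: prob_eq_1)
qed

lemma prob_word_event_one:
  "leaving (\<lambda>i. 0 < i) 1 ws \<Longrightarrow> prob (word_event 1 ws) = embedded_prob Q 1 ws"
proof -
  have "leaving (\<lambda>i. 0 < i) i ws \<Longrightarrow> leaving (\<lambda>i. Q i i < 0) i ws" for i
    using Q_diagonal by (induction ws arbitrary: i) auto
  then show "leaving (\<lambda>i. 0 < i) 1 ws \<Longrightarrow> prob (word_event 1 ws) = embedded_prob Q 1 ws"
    using prob_word_event[of 1 ws] prob_start by simp
qed

lemma prob_states: "admissible 1 ds \<Longrightarrow> prob (word_event 1 (states 1 ds)) = prod_list (map q ds)"
  using prob_word_event[OF leaving_states] prob_start embedded_prob_states by simp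

text \<open>The matrix has no entry for going down by more than one, so a word that is not made of
  steps has probability 0 and can be discarded.\<close>

lemma positive_word:
  "leaving (\<lambda>i. 0 < i) i ws \<Longrightarrow> embedded_prob Q i ws \<noteq> 0 \<Longrightarrow> \<exists>ds. ws = states i ds \<and> admissible i ds"
proof (induction ws arbitrary: i)
  case Nil
  then show ?case by (intro exI[of _ "[]"]) simp
next
  case (Cons j ws)
  then obtain ds where ds: "ws = states j ds" "admissible j ds" by auto
  have "i \<le> j + 1" "j \<noteq> i" "0 < i" using Cons.prems by (auto simp: weighted_branching_Q_def split: if_splits)
  then show ?case using ds by (intro exI[of _ "(j + 1 - i) # ds"]) auto
qed

text \<open>The steps \<open>ds\<close> already made are part of the event because only
  probabilities of words from time 0 are known; \<open>l\<close> counts just the continuation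
  \<open>es\<close>.\<close>

definition hit_event :: "nat \<Rightarrow> nat list \<Rightarrow> (nat \<Rightarrow>\<^sub>0 nat) \<Rightarrow> 'a set" where
  "hit_event n ds l = (\<Union>es\<in>{es. length es \<le> n \<and> admissible (endpoint 1 ds) es \<and>
     endpoint (endpoint 1 ds) es = 0 \<and> step_counts N es = l}. word_event 1 (states 1 (ds @ es)))"

lemma hit_event_sets [measurable]: "hit_event n ds l \<in> events"
  unfolding hit_event_def by (rule sets.countable_UN') auto

lemma hit_event_0: "hit_event 0 ds l = (if endpoint 1 ds = 0 \<and> l = 0 then word_event 1 (states 1 ds) else {})"
  by (auto simp: hit_event_def)

lemma hit_event_end:
  "endpoint 1 ds = 0 \<Longrightarrow> hit_event n ds l = (if l = 0 then word_event 1 (states 1 ds) else {})"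
  by (auto simp: hit_event_def admissible_zero)

lemma word_event_unique_step:
  assumes "\<omega> \<in> word_event 1 (states 1 (ds @ d # es))" "\<omega> \<in> word_event 1 (states 1 (ds @ d' # es'))"
    and "0 < endpoint 1 ds"
  shows "d = d'"
proof -
  have "endpoint 1 ds + d - 1 = endpoint 1 ds + d' - 1"
    using assms(1,2) jump_path_unique_head[of "\<lambda>t. X t \<omega>" 0 "states 1 ds"]
    by (auto simp: word_event_def states_append)
  then show ?thesis using assms(3) by simp
qed

text \<open>The induction moves the first step of the continuation into the prefix. Different next
  steps give disjoint events, so the probabilities add up to the first-step sum in
  \<open>hit_within\<close>.\<close>

lemma prob_hit_event:
  "admissible 1 ds \<Longrightarrow> prob (hit_event n ds l) = prod_list (map q ds) * hit_within n (endpoint 1 ds) l"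
proof (induction n arbitrary: ds l)
  case 0
  then show ?case using prob_states[of ds] by (simp add: hit_event_0)
next
  case (Suc n)
  show ?case
  proof (cases "endpoint 1 ds = 0")
    case True
    then show ?thesis using prob_states[OF Suc.prems] by (simp add: hit_event_end)
  next
    case False
    define i where "i = endpoint 1 ds"
    \<comment> \<open>The cases mirror \<open>mult_var\<close>: a marked step uses up one unit of
      its coordinate. The empty event at \<open>d = 1\<close> matches
      \<open>q 1 = 0\<close>.\<close>
    define F where "F d = (if d = 1 then {} else if d \<in> N
        then if Poly_Mapping.lookup l d = 0 then {} else hit_event n (ds @ [d]) (l - unit_vec d)
        else hit_event n (ds @ [d]) l)" for d
    have endp: "endpoint 1 (ds @ [d]) = i + d - 1" for d by (simp add: endpoint_append i_def)
    have F_iff: "\<omega> \<in> F d \<longleftrightarrow> d \<noteq> 1 \<and> (\<exists>es. length es \<le> n \<and> admissible (i + d - 1) es \<and> endpoint (i + d - 1) es = 0 \<and>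
        step_counts N (d # es) = l \<and> \<omega> \<in> word_event 1 (states 1 (ds @ d # es)))" for \<omega> d
      unfolding F_def step_counts_Cons_iff hit_event_def endp by auto
    have union: "hit_event (Suc n) ds l = (\<Union>d. F d)"
    proof (intro set_eqI iffI)
      fix \<omega> assume "\<omega> \<in> hit_event (Suc n) ds l"
      then obtain es where es: "length es \<le> Suc n" "admissible i es" "endpoint i es = 0" "step_counts N es = l"
        "\<omega> \<in> word_event 1 (states 1 (ds @ es))"
        by (auto simp: hit_event_def i_def)
      moreover from es False obtain d es' where "es = d # es'" by (cases es) (auto simp: i_def)
      ultimately show "\<omega> \<in> (\<Union>d. F d)"
        by (intro UN_I[of d]) (auto simp: F_iff simp del: step_counts.simps)
    next
      fix \<omega> assume "\<omega> \<in> (\<Union>d. F d)"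
      then obtain d es where "d \<noteq> 1" "length es \<le> n" "admissible (i + d - 1) es" "endpoint (i + d - 1) es = 0"
        "step_counts N (d # es) = l" "\<omega> \<in> word_event 1 (states 1 (ds @ d # es))"
        by (auto simp: F_iff simp del: step_counts.simps)
      then show "\<omega> \<in> hit_event (Suc n) ds l"
        unfolding hit_event_def using False
        by (intro UN_I[of "d # es"]) (auto simp: i_def simp del: step_counts.simps)
    qed
    have disj: "disjoint_family F"
      unfolding disjoint_family_on_def
    proof (intro ballI impI)
      fix d d' :: nat assume "d \<noteq> d'"
      then show "F d \<inter> F d' = {}"
        using word_event_unique_step[of _ ds d _ d'] False
        by (auto simp: F_iff simp del: step_counts.simps)
    qed
    have sets: "range F \<subseteq> events" unfolding F_def by auto
    have "prob (F d) = prod_list (map q ds) * (q d * mult_var N d (hit_within n (i + d - 1)) l)" for d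
    proof (cases "d = 1")
      case True
      then show ?thesis using q_one by (simp add: F_def)
    next
      case d: False
      then have "admissible 1 (ds @ [d])" using Suc.prems False by (simp add: admissible_append)
      then have "prob (hit_event n (ds @ [d]) l') = prod_list (map q ds) * (q d * hit_within n (i + d - 1) l')" for l'
        unfolding Suc.IH[OF \<open>admissible 1 (ds @ [d])\<close>] endp by simp
      then show ?thesis using d by (simp add: F_def mult_var_def)
    qed
    then have s1: "(\<lambda>d. prod_list (map q ds) * (q d * mult_var N d (hit_within n (i + d - 1)) l)) sums prob (hit_event (Suc n) ds l)"
      using finite_measure_UNION[OF sets disj] unfolding union by simp
    have s2: "(\<lambda>d. prod_list (map q ds) * (q d * mult_var N d (hit_within n (i + d - 1)) l)) sums
        (prod_list (map q ds) * hit_within (Suc n) i l)"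
      using False by (simp add: i_def) (intro sums_mult summable_sums summable_q_mult mult_var_hit_within_bounds)
    from sums_unique2[OF s1 s2] show ?thesis by (simp only: i_def)
  qed
qed

definition extinct :: "'a set" where
  "extinct = {\<omega> \<in> space M. extinction_time (\<lambda>t. X t \<omega>) < \<infinity>}"

definition Y :: "nat \<Rightarrow> 'a \<Rightarrow> nat" where
  "Y k \<omega> = crossing_number k (\<lambda>t. X t \<omega>) (extinction_time (\<lambda>t. X t \<omega>))"

definition Y_event :: "(nat \<Rightarrow>\<^sub>0 nat) \<Rightarrow> 'a set" where
  "Y_event l = {\<omega> \<in> extinct. \<forall>k\<in>N. Y k \<omega> = Poly_Mapping.lookup l k}"

lemma word_eventD:
  assumes "\<omega> \<in> word_event i ws" "hitting_word i ws"
  shows "\<omega> \<in> extinct" "Y k \<omega> = crossing_count k i ws"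
proof -
  from assms obtain T where T: "\<omega> \<in> space M" "X 0 \<omega> = i" "jump_path (\<lambda>t. X t \<omega>) 0 ws T"
    by (auto simp: word_event_def)
  then show "\<omega> \<in> extinct"
    using extinction_time_jump_path[OF T(3)] assms(2) by (simp add: extinct_def)
  show "Y k \<omega> = crossing_count k i ws"
    unfolding Y_def using crossing_number_jump_path[OF T(3), of k] T(2) assms(2) by simp
qed

lemma extinct_eq: "extinct = (\<Union>(i, ws)\<in>{(i, ws). hitting_word i ws}. word_event i ws)"
proof (intro set_eqI iffI)
  fix \<omega> assume \<omega>: "\<omega> \<in> extinct"
  then have "\<omega> \<in> space M" by (simp add: extinct_def)
  then obtain ws T where "jump_path (\<lambda>t. X t \<omega>) 0 ws T" "hitting_word (X 0 \<omega>) ws"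
    using exists_hitting_word[OF right_continuous non_explosive] \<omega> unfolding extinct_def by blast
  then show "\<omega> \<in> (\<Union>(i, ws)\<in>{(i, ws). hitting_word i ws}. word_event i ws)"
    using \<open>\<omega> \<in> space M\<close> by (auto simp: word_event_def)
qed (use word_eventD in blast)

lemma extinct_sets [measurable]: "extinct \<in> events"
  unfolding extinct_eq by (rule sets.countable_UN') auto

text \<open>If 0 is never reached, the crossing number is the cardinality of all crossing times.
  Conditioning on extinction ignores these paths, but the integrand is required to be measurable on
  the whole space.\<close>

lemma card_crossing_times_sets:
  "{\<omega> \<in> space M. card (crossing_times k (\<lambda>t. X t \<omega>)) = m} \<in> events"
proof -
  define G where "G n = (\<Union>(i, ws)\<in>{(i, ws). n \<le> crossing_count k i ws}. word_event i ws)" for n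
  have [measurable]: "G n \<in> events" for n
    unfolding G_def by (rule sets.countable_UN') auto
  have G: "\<omega> \<in> G n \<longleftrightarrow> (\<exists>F. F \<subseteq> crossing_times k (\<lambda>t. X t \<omega>) \<and> finite F \<and> card F = n)" if "\<omega> \<in> space M" for \<omega> n
  proof -
    have "\<omega> \<in> G n \<longleftrightarrow> (\<exists>ws T. jump_path (\<lambda>t. X t \<omega>) 0 ws T \<and> n \<le> crossing_count k (X 0 \<omega>) ws)"
      using that by (auto simp: G_def word_event_def)
    also have "\<dots> \<longleftrightarrow> (\<exists>F. F \<subseteq> crossing_times k (\<lambda>t. X t \<omega>) \<and> finite F \<and> card F = n)"
      by (rule crossing_count_ge_iff) (rule right_continuous[OF that], assumption, rule non_explosive[OF that])
    finally show ?thesis .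
  qed
  have "{\<omega> \<in> space M. card (crossing_times k (\<lambda>t. X t \<omega>)) = m} =
     {\<omega> \<in> space M. (\<omega> \<in> G m \<and> \<omega> \<notin> G (Suc m)) \<or> (m = 0 \<and> (\<forall>n. \<omega> \<in> G n))}"
  proof (rule Collect_cong, rule conj_cong[OF refl])
    fix \<omega> assume "\<omega> \<in> space M"
    then show "card (crossing_times k (\<lambda>t. X t \<omega>)) = m \<longleftrightarrow>
        (\<omega> \<in> G m \<and> \<omega> \<notin> G (Suc m)) \<or> (m = 0 \<and> (\<forall>n. \<omega> \<in> G n))"
      unfolding G[OF \<open>\<omega> \<in> space M\<close>] by (intro card_eq_iff_subsets)
  qed
  also have "\<dots> \<in> events" by measurable
  finally show ?thesis .
qed

lemma measurable_Y [measurable]: "Y k \<in> M \<rightarrow>\<^sub>M count_space UNIV"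
proof (rule measurable_count_space_eq_countable[THEN iffD2], simp, intro conjI ballI Pi_I)
  fix m :: nat
  define E where "E = (\<Union>(i, ws)\<in>{(i, ws). hitting_word i ws \<and> crossing_count k i ws = m}. word_event i ws)"
  have [measurable]: "E \<in> events"
    unfolding E_def by (rule sets.countable_UN') auto
  note card_crossing_times_sets [measurable]
  have in_E: "Y k \<omega> = m \<longleftrightarrow> \<omega> \<in> E" if \<omega>: "\<omega> \<in> extinct" for \<omega>
  proof
    assume "Y k \<omega> = m"
    moreover obtain i ws where "hitting_word i ws" "\<omega> \<in> word_event i ws"
      using \<omega> unfolding extinct_eq by auto
    ultimately show "\<omega> \<in> E" using word_eventD(2)[of \<omega> i ws k] by (auto simp: E_def)
  next
    assume "\<omega> \<in> E"
    then show "Y k \<omega> = m" using word_eventD(2) by (auto simp: E_def)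
  qed
  have not_extinct: "Y k \<omega> = card (crossing_times k (\<lambda>t. X t \<omega>))" if "\<omega> \<in> space M" "\<omega> \<notin> extinct" for \<omega>
    using that by (simp add: Y_def crossing_number_eq extinct_def)
  have "Y k -` {m} \<inter> space M = (extinct \<inter> E) \<union>
      ({\<omega> \<in> space M. card (crossing_times k (\<lambda>t. X t \<omega>)) = m} - extinct)"
  proof (intro set_eqI)
    fix \<omega>
    show "\<omega> \<in> Y k -` {m} \<inter> space M \<longleftrightarrow> \<omega> \<in> (extinct \<inter> E) \<union>
      ({\<omega> \<in> space M. card (crossing_times k (\<lambda>t. X t \<omega>)) = m} - extinct)"
    proof (cases "\<omega> \<in> extinct")
      case True
      then show ?thesis using in_E[OF True] True by (auto simp: extinct_def)
    next
      case False
      then show ?thesis using not_extinct[of \<omega>] by auto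
    qed
  qed
  also have "\<dots> \<in> events" by (intro sets.Un sets.Int sets.Diff) measurable
  finally show "Y k -` {m} \<inter> space M \<in> events" .
qed simp

lemma Y_event_sets [measurable]: "Y_event l \<in> events"
proof -
  have "Y_event l = extinct \<inter> {\<omega> \<in> space M. \<forall>k\<in>N. Y k \<omega> = Poly_Mapping.lookup l k}" by (auto simp: Y_event_def extinct_def)
  also have "\<dots> \<in> events"
    using finite_N by (intro sets.Int extinct_sets) (measurable)
  finally show ?thesis .
qed

text \<open>Up to a null set the event is the increasing union of \<open>hit_event n [] l\<close>,
  whose probabilities are \<open>hit_within n 1 l\<close>.\<close>

theorem prob_Y_event:
  assumes l: "l \<in> vecs N"
  shows "prob (Y_event l) = hit 1 l"
proof -
  have hit_eventD: "\<omega> \<in> Y_event l" if "\<omega> \<in> hit_event n [] l" for \<omega> n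
  proof -
    from that obtain ds where ds: "admissible 1 ds" "endpoint 1 ds = 0" "step_counts N ds = l"
      "\<omega> \<in> word_event 1 (states 1 ds)"
      by (auto simp: hit_event_def)
    then show ?thesis
      using word_eventD[OF ds(4) hitting_word_states[OF ds(1,2)]] crossing_count_states[OF ds(1)]
      by (auto simp: Y_event_def lookup_step_counts)
  qed
  have "AE \<omega> in M. prob (word_event 1 ws) = 0 \<longrightarrow> \<omega> \<notin> word_event 1 ws" for ws
  proof (cases "prob (word_event 1 ws) = 0")
    case True
    then have "AE \<omega> in M. \<omega> \<notin> word_event 1 ws" by (subst (asm) prob_eq_0) auto
    then show ?thesis by eventually_elim simp
  qed simp
  \<comment> \<open>There are only countably many words, so a single null set removes all those of
    probability 0.\<close>
  then have null: "AE \<omega> in M. \<forall>ws. prob (word_event 1 ws) = 0 \<longrightarrow> \<omega> \<notin> word_event 1 ws"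
    by (simp add: AE_all_countable)
  have "AE \<omega> in M. \<omega> \<in> Y_event l \<longleftrightarrow> \<omega> \<in> (\<Union>n. hit_event n [] l)"
    using start null AE_space
  proof eventually_elim
    case (elim \<omega>)
    show ?case
    proof
      assume Y: "\<omega> \<in> Y_event l"
      then have "\<omega> \<in> extinct" by (simp add: Y_event_def)
      then obtain ws where ws: "\<omega> \<in> word_event 1 ws" "hitting_word 1 ws"
        unfolding extinct_eq using elim(1) by (auto simp: word_event_def)
      then obtain T where T: "jump_path (\<lambda>t. X t \<omega>) 0 ws T" by (auto simp: word_event_def)
      have leaving: "leaving (\<lambda>i. 0 < i) 1 ws"
        using jump_path_leaving[OF T] ws(2) elim(1) by (simp add: hitting_word_def)
      have "embedded_prob Q 1 ws \<noteq> 0"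
        using elim(2) ws(1) prob_word_event_one[OF leaving] by auto
      then obtain ds where ds: "ws = states 1 ds" "admissible 1 ds"
        using positive_word[OF leaving] by blast
      have "endpoint 1 ds = 0"
        using ws(2) last_states[of 1 ds] by (simp add: hitting_word_def ds(1))
      have "step_counts N ds = l"
      proof (rule vecs_eqI[OF step_counts_vecs l])
        fix k assume k: "k \<in> N"
        then have "Poly_Mapping.lookup l k = Y k \<omega>" using Y by (simp add: Y_event_def)
        also have "\<dots> = count_list ds k"
          using word_eventD(2)[OF ws] crossing_count_states[OF ds(2)] ds(1) by simp
        finally show "Poly_Mapping.lookup (step_counts N ds) k = Poly_Mapping.lookup l k" using k by (simp add: lookup_step_counts)
      qed
      then have "\<omega> \<in> hit_event (length ds) [] l"
        unfolding hit_event_def using ds ws(1) \<open>endpoint 1 ds = 0\<close> by (intro UN_I[of ds]) auto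
      then show "\<omega> \<in> (\<Union>n. hit_event n [] l)" by blast
    qed (use hit_eventD in blast)
  qed
  then have "prob (Y_event l) = prob (\<Union>n. hit_event n [] l)"
    by (intro finite_measure_eq_AE) auto
  moreover have "(\<lambda>n. prob (hit_event n [] l)) \<longlonglongrightarrow> prob (\<Union>n. hit_event n [] l)"
  proof (rule finite_Lim_measure_incseq)
    show "incseq (\<lambda>n. hit_event n [] l)"
      unfolding incseq_def hit_event_def by (intro allI impI UN_mono) auto
  qed auto
  moreover have "prob (hit_event n [] l) = hit_within n 1 l" for n
    using prob_hit_event[of "[]"] by simp
  ultimately show ?thesis using LIMSEQ_unique[OF hit_within_tendsto] by simp
qed

end

section \<open>From probabilities to the generating function\<close>

lemma integral_uniform_measure:
  fixes f :: "'a \<Rightarrow> real"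
  assumes [measurable]: "f \<in> borel_measurable M" "A \<in> sets M"
    and "\<And>x. 0 \<le> f x" "\<And>x. f x \<le> 1" "emeasure M A < \<infinity>"
  shows "(\<integral>x. f x \<partial>uniform_measure M A) = (\<integral>x. f x * indicator A x \<partial>M) / measure M A"
proof -
  define I where "I = (\<integral>x. f x * indicator A x \<partial>M)"
  have int: "integrable M (\<lambda>x. f x * indicator A x)"
  proof (rule Bochner_Integration.integrable_bound)
    show "integrable M (indicator A :: 'a \<Rightarrow> real)" using assms by simp
  qed (use assms(3,4) in \<open>auto simp: indicator_def\<close>)
  have "(\<integral>x. f x \<partial>uniform_measure M A) = enn2real (\<integral>\<^sup>+x. ennreal (f x) \<partial>uniform_measure M A)"
    using assms(3) by (intro integral_eq_nn_integral) auto
  also have "(\<integral>\<^sup>+x. ennreal (f x) \<partial>uniform_measure M A) =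
      (\<integral>\<^sup>+x. ennreal (f x) * indicator A x \<partial>M) / emeasure M A"
    by (rule nn_integral_uniform_measure) auto
  also have "(\<integral>\<^sup>+x. ennreal (f x) * indicator A x \<partial>M) = (\<integral>\<^sup>+x. ennreal (f x * indicator A x) \<partial>M)"
    by (intro nn_integral_cong) (auto simp: indicator_def)
  also have "\<dots> = ennreal I"
    unfolding I_def using assms(3) by (intro nn_integral_eq_integral int) auto
  also have "emeasure M A = ennreal (measure M A)"
    using assms(5) by (intro emeasure_eq_ennreal_measure) auto
  also have "enn2real (ennreal I / ennreal (measure M A)) = I / measure M A"
  proof (cases "measure M A = 0")
    \<comment> \<open>This happens for the extinction event if \<open>b 0 = 0\<close>. Both
      quotients are then 0 by the conventions for division by 0.\<close>
    case True
    then have "emeasure M A = 0"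
      using assms(5) by (simp add: emeasure_eq_ennreal_measure)
    then have "AE x in M. x \<notin> A" by (intro AE_not_in null_setsI) auto
    then have "I = (\<integral>x. 0 \<partial>M)" unfolding I_def by (intro integral_cong_AE) auto
    then show ?thesis by simp
  next
    case False
    have "0 \<le> I" unfolding I_def using assms(3) by simp
    then show ?thesis using False by (simp add: divide_ennreal zero_less_measure_iff)
  qed
  finally show ?thesis unfolding I_def .
qed

text \<open>For nonnegative terms, unconditional summability follows from a single increasing
  exhaustion by finite sets, since every finite partial sum is below one of these.\<close>

lemma has_sum_exhausting:
  fixes f :: "'a \<Rightarrow> real"
  assumes nonneg: "\<And>x. x \<in> A \<Longrightarrow> 0 \<le> f x"
    and F: "\<And>n. finite (F n)" "\<And>n. F n \<subseteq> A"
    and exhaust: "\<And>S. finite S \<Longrightarrow> S \<subseteq> A \<Longrightarrow> \<exists>n. S \<subseteq> F n"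
    and mono: "\<And>m n. m \<le> n \<Longrightarrow> F m \<subseteq> F n"
    and lim: "(\<lambda>n. sum f (F n)) \<longlonglongrightarrow> I"
  shows "(f has_sum I) A"
proof -
  have "incseq (\<lambda>n. sum f (F n))"
  proof (rule incseq_SucI, rule sum_mono2)
    fix n x
    show "F n \<subseteq> F (Suc n)" by (rule mono) simp
    show "0 \<le> f x" if "x \<in> F (Suc n) - F n" using that F(2) nonneg by auto
  qed (rule F)
  then have le: "sum f (F n) \<le> I" for n using lim by (rule incseq_le)
  have le': "sum f S \<le> I" if S: "finite S" "S \<subseteq> A" for S
  proof -
    obtain n where "S \<subseteq> F n" using exhaust[OF S] by blast
    then have "sum f S \<le> sum f (F n)"
    proof (rule sum_mono2[OF F(1)])
      fix x assume "x \<in> F n - S"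
      then show "0 \<le> f x" using F(2) nonneg by auto
    qed
    then show ?thesis using le[of n] by linarith
  qed
  have summable: "f summable_on A"
    by (rule nonneg_bdd_above_summable_on[OF nonneg], assumption)
      (use le' in \<open>auto intro!: bdd_aboveI2[where M = I]\<close>)
  have "infsum f A \<le> I" by (rule infsum_le_finite_sums[OF summable le'])
  moreover have "I \<le> infsum f A"
  proof (rule LIMSEQ_le_const2[OF lim], intro exI allI impI)
    show "sum f (F n) \<le> infsum f A" for n
      by (rule finite_sum_le_infsum[OF summable F]) (use nonneg in auto)
  qed
  ultimately show ?thesis using summable by (metis antisym has_sum_infsum)
qed

definition coord_box :: "nat set \<Rightarrow> nat \<Rightarrow> (nat \<Rightarrow>\<^sub>0 nat) set" where
  "coord_box N n = {l \<in> vecs N. \<forall>k\<in>N. Poly_Mapping.lookup l k \<le> n}"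

lemma finite_coord_box:
  assumes "finite N"
  shows "finite (coord_box N n)"
proof -
  \<comment> \<open>\<open>L\<close> is the upper corner of the box. Each vector of the box is the
    first part of a split of \<open>L\<close>, so \<open>finite_splits\<close> gives
    finiteness.\<close>
  define L where "L = (\<Sum>k\<in>N. Poly_Mapping.single k n)"
  have L: "Poly_Mapping.lookup L k = (if k \<in> N then n else 0)" for k
    unfolding L_def lookup_sum using assms by (simp add: lookup_single when_def)
  have "coord_box N n \<subseteq> fst ` splits L"
  proof
    fix l assume l: "l \<in> coord_box N n"
    have "Poly_Mapping.lookup l k \<le> Poly_Mapping.lookup L k" for k
      using l by (cases "k \<in> N") (auto simp: L coord_box_def vecs_def in_keys_iff subset_eq)
    then have "l + (L - l) = L"
      by (intro poly_mapping_eqI) (simp add: lookup_add lookup_minus)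
    then show "l \<in> fst ` splits L" by (intro image_eqI[of _ _ "(l, L - l)"]) auto
  qed
  then show ?thesis by (rule finite_subset) simp
qed

lemma coord_box_exhausting:
  assumes "finite S" "S \<subseteq> vecs N"
  shows "\<exists>n. S \<subseteq> coord_box N n"
proof
  show "S \<subseteq> coord_box N (\<Sum>l\<in>S. total l)"
  proof
    fix l assume l: "l \<in> S"
    have "Poly_Mapping.lookup l k \<le> total l" for k
    proof (cases "k \<in> Poly_Mapping.keys l")
      case True
      then show ?thesis unfolding total_def by (intro member_le_sum) auto
    qed (simp add: in_keys_iff)
    moreover have "total l \<le> (\<Sum>l\<in>S. total l)" using l assms(1) by (intro member_le_sum) auto
    ultimately show "l \<in> coord_box N (\<Sum>l\<in>S. total l)"
      using l assms(2) by (auto simp: coord_box_def intro: order.trans)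
  qed
qed

context branching_process
begin

lemma ex_Y_vec: "\<exists>l\<in>vecs N. \<forall>k\<in>N. Poly_Mapping.lookup l k = Y k \<omega>"
proof -
  define l where "l = (\<Sum>k\<in>N. Poly_Mapping.single k (Y k \<omega>))"
  have "Poly_Mapping.lookup l k = (if k \<in> N then Y k \<omega> else 0)" for k
    unfolding l_def lookup_sum using finite_N by (simp add: lookup_single when_def)
  then show ?thesis by (intro bexI[of _ l]) (auto simp: vecs_def in_keys_iff split: if_splits)
qed

context
  fixes v :: "nat \<Rightarrow> real"
  assumes v: "v \<in> N \<rightarrow> {0..1}"
begin

lemma vec_power_bounds: "0 \<le> vec_power N v l" "vec_power N v l \<le> 1"
  using v unfolding vec_power_def by (auto intro!: prod_nonneg prod_le_1 simp: power_le_one Pi_iff)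

lemma Y_power_bounds: "0 \<le> (\<Prod>k\<in>N. v k ^ Y k \<omega>)" "(\<Prod>k\<in>N. v k ^ Y k \<omega>) \<le> 1"
  using v by (auto intro!: prod_nonneg prod_le_1 simp: power_le_one Pi_iff)

text \<open>For each outcome exactly one vector in \<open>vecs N\<close> has the observed counts as
  coordinates, so at most one term of the sum survives.\<close>

lemma sum_Y_event:
  assumes F: "finite F" "F \<subseteq> vecs N" and l: "l \<in> vecs N" "\<forall>k\<in>N. Poly_Mapping.lookup l k = Y k \<omega>"
  shows "(\<Sum>l\<in>F. vec_power N v l * indicator (Y_event l) \<omega>) =
    (if l \<in> F then (\<Prod>k\<in>N. v k ^ Y k \<omega>) * indicator extinct \<omega> else 0)"
proof -
  have eq: "\<omega> \<in> Y_event l' \<longleftrightarrow> \<omega> \<in> extinct \<and> l' = l" if "l' \<in> F" for l'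
    using that F(2) l vecs_eqI[of l' N l] by (auto simp: Y_event_def)
  have "vec_power N v l = (\<Prod>k\<in>N. v k ^ Y k \<omega>)"
    unfolding vec_power_def using l(2) by (intro prod.cong) auto
  then have "(\<Sum>l\<in>F. vec_power N v l * indicator (Y_event l) \<omega>) =
      (\<Sum>l'\<in>F. if l' = l then (\<Prod>k\<in>N. v k ^ Y k \<omega>) * indicator extinct \<omega> else 0)"
    by (intro sum.cong) (auto simp: eq indicator_def)
  then show ?thesis using F(1) by simp
qed

text \<open>For each outcome the partial sums over growing boxes become constant once the box
  contains the observed vector, and they stay in \<open>{0..1}\<close>; integrating them gives the
  partial sums of the series.\<close>

lemma has_sum_hit:
  "((\<lambda>l. hit 1 l * vec_power N v l) has_sum (\<integral>\<omega>. (\<Prod>k\<in>N. v k ^ Y k \<omega>) * indicator extinct \<omega> \<partial>M)) (vecs N)"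
proof (rule has_sum_exhausting[where F = "coord_box N"])
  define g where "g n \<omega> = (\<Sum>l\<in>coord_box N n. vec_power N v l * indicator (Y_event l) \<omega>)" for n \<omega>
  have box: "finite (coord_box N n)" "coord_box N n \<subseteq> vecs N" for n using finite_coord_box[OF finite_N] by (auto simp: coord_box_def)
  have "(\<lambda>n. \<integral>\<omega>. g n \<omega> \<partial>M) \<longlonglongrightarrow> (\<integral>\<omega>. (\<Prod>k\<in>N. v k ^ Y k \<omega>) * indicator extinct \<omega> \<partial>M)"
  proof (rule integral_dominated_convergence[where w = "\<lambda>_. 1"])
    show "AE \<omega> in M. (\<lambda>n. g n \<omega>) \<longlonglongrightarrow> (\<Prod>k\<in>N. v k ^ Y k \<omega>) * indicator extinct \<omega>"
    proof (rule AE_I2)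
      fix \<omega>
      obtain l where l: "l \<in> vecs N" "\<forall>k\<in>N. Poly_Mapping.lookup l k = Y k \<omega>" using ex_Y_vec by blast
      then obtain n0 where "{l} \<subseteq> coord_box N n0" using coord_box_exhausting[of "{l}" N] by auto
      then have "l \<in> coord_box N n" if "n \<ge> n0" for n using that by (force simp: coord_box_def)
      then have "g n \<omega> = (\<Prod>k\<in>N. v k ^ Y k \<omega>) * indicator extinct \<omega>" if "n \<ge> n0" for n
        unfolding g_def using sum_Y_event[OF box l, of n] that by simp
      then show "(\<lambda>n. g n \<omega>) \<longlonglongrightarrow> (\<Prod>k\<in>N. v k ^ Y k \<omega>) * indicator extinct \<omega>"
        by (intro tendsto_eventually) (auto simp: eventually_sequentially)
    qed
    show "AE \<omega> in M. norm (g n \<omega>) \<le> 1" for n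
    proof (rule AE_I2)
      fix \<omega>
      obtain l where l: "l \<in> vecs N" "\<forall>k\<in>N. Poly_Mapping.lookup l k = Y k \<omega>" using ex_Y_vec by blast
      show "norm (g n \<omega>) \<le> 1"
        unfolding g_def sum_Y_event[OF box l] using Y_power_bounds[of \<omega>] by (auto simp: indicator_def)
    qed
  qed (auto simp: g_def)
  moreover have "(\<integral>\<omega>. g n \<omega> \<partial>M) = (\<Sum>l\<in>coord_box N n. hit 1 l * vec_power N v l)" for n
  proof -
    have "integrable M (indicator (Y_event l) :: 'a \<Rightarrow> real)" for l
      by (intro integrable_real_indicator) (auto simp: emeasure_eq_measure)
    then have "(\<integral>\<omega>. g n \<omega> \<partial>M) = (\<Sum>l\<in>coord_box N n. vec_power N v l * prob (Y_event l))"
      unfolding g_def by (subst Bochner_Integration.integral_sum) auto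
    also have "\<dots> = (\<Sum>l\<in>coord_box N n. hit 1 l * vec_power N v l)"
      using box(2) by (intro sum.cong) (auto simp: prob_Y_event subset_eq)
    finally show ?thesis .
  qed
  ultimately show "(\<lambda>n. \<Sum>l\<in>coord_box N n. hit 1 l * vec_power N v l) \<longlonglongrightarrow>
      (\<integral>\<omega>. (\<Prod>k\<in>N. v k ^ Y k \<omega>) * indicator extinct \<omega> \<partial>M)"
    by simp
qed (use finite_coord_box[OF finite_N] hit_nonneg vec_power_bounds coord_box_exhausting in \<open>auto simp: coord_box_def\<close>)

lemma crossing_pgf_eq:
  "crossing_pgf M X N v = inverse (prob extinct) * (\<Sum>\<^sub>\<infinity>l\<in>vecs N. hit 1 l * vec_power N v l)"
proof -
  have "crossing_pgf M X N v = (\<integral>\<omega>. (\<Prod>k\<in>N. v k ^ Y k \<omega>) \<partial>uniform_measure M extinct)"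
    by (simp add: crossing_pgf_def Y_def extinct_def)
  also have "\<dots> = (\<integral>\<omega>. (\<Prod>k\<in>N. v k ^ Y k \<omega>) * indicator extinct \<omega> \<partial>M) / prob extinct"
    using Y_power_bounds by (intro integral_uniform_measure) (auto simp: less_top[symmetric])
  also have "\<dots> = inverse (prob extinct) * (\<Sum>\<^sub>\<infinity>l\<in>vecs N. hit 1 l * vec_power N v l)"
    using infsumI[OF has_sum_hit] by (simp add: field_simps)
  finally show ?thesis .
qed

end

end

theorem theorem3p1:
  fixes M :: "'a measure"
    and X :: "real \<Rightarrow> 'a \<Rightarrow> nat"
    and p :: "real \<Rightarrow> nat \<Rightarrow> nat \<Rightarrow> real"
    and b w :: "nat \<Rightarrow> real"
    and N :: "nat set"
    and \<rho> :: real
  assumes params: "weighted_branching_params b w"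
    and chain: "regular_ctmc M (weighted_branching_Q b w) p X"
    and start: "AE \<omega> in M. X 0 \<omega> = 1"
    and N: "finite N" "1 \<notin> N" "\<forall>k\<in>N. 0 < b k"
    and \<rho>: "is_min_root (B_gf b) \<rho>"
  shows "(\<forall>r. crossing_recursion b N r \<longrightarrow>
           (\<forall>v \<in> N \<rightarrow> {0..1}.
              (\<lambda>l. r l * vec_power N v l) summable_on vecs N \<and>
              crossing_pgf M X N v = inverse \<rho> * (\<Sum>\<^sub>\<infinity>l\<in>vecs N. r l * vec_power N v l)))
       \<and> (\<exists>r. crossing_recursion_summed b N r)
       \<and> (\<forall>r. crossing_recursion_summed b N r \<longrightarrow>
           (\<forall>v \<in> N \<rightarrow> {0..1}.
              (\<lambda>l. r l * vec_power N v l) summable_on vecs N \<and>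
              crossing_pgf M X N v = inverse \<rho> * (\<Sum>\<^sub>\<infinity>l\<in>vecs N. r l * vec_power N v l)))"
proof -
  have branching: "branching b N'" if "finite N'" "1 \<notin> N'" "\<forall>k\<in>N'. 0 < b k" for N'
    using params that by unfold_locales (auto simp: weighted_branching_params_def)
  have process: "branching_process M b w p X N'" if "branching b N'" for N'
    using params start
    by (intro branching_process.intro chain that branching_process_axioms.intro)
      (auto simp: weighted_branching_params_def)
  interpret branching_process M b w p X N by (rule process branching N)+
  \<comment> \<open>Without marked steps, the only crossing vector is 0 and its event is extinction
    itself, while \<open>B_bar\<close> becomes \<open>B_gf\<close>. This yields the extinction
    probability.\<close>
  interpret plain: branching_process M b w p X "{}" by (rule process branching)+ auto
  have "plain.Y_event 0 = extinct" by (simp add: plain.Y_event_def)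
  then have "prob extinct = offspring.hit q {} 1 0"
    using plain.prob_Y_event[of 0] by (simp add: vecs_def)
  then have prob_extinct: "prob extinct = \<rho>"
    using is_min_root_unique[OF _ \<rho>] plain.is_min_root_hit by (simp add: B_bar_empty)
  have summed: "(\<lambda>l. r l * vec_power N v l) summable_on vecs N \<and>
      crossing_pgf M X N v = inverse \<rho> * (\<Sum>\<^sub>\<infinity>l\<in>vecs N. r l * vec_power N v l)"
    if r: "crossing_recursion_summed b N r" and v: "v \<in> N \<rightarrow> {0..1}" for r v
  proof -
    have eq: "r l = hit 1 l" if "l \<in> vecs N" for l
      using crossing_recursion_summed_unique[OF r crossing_recursion_summed_hit that] .
    have "(\<lambda>l. r l * vec_power N v l) summable_on vecs N"
      using has_sum_imp_summable[OF has_sum_hit[OF v]] by (rule summable_on_cong[THEN iffD1, rotated]) (simp add: eq)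
    moreover have "(\<Sum>\<^sub>\<infinity>l\<in>vecs N. r l * vec_power N v l) = (\<Sum>\<^sub>\<infinity>l\<in>vecs N. hit 1 l * vec_power N v l)"
      by (rule infsum_cong) (simp add: eq)
    ultimately show ?thesis using crossing_pgf_eq[OF v] prob_extinct by simp
  qed
  have "(\<lambda>l. r l * vec_power N v l) summable_on vecs N \<and>
      crossing_pgf M X N v = inverse \<rho> * (\<Sum>\<^sub>\<infinity>l\<in>vecs N. r l * vec_power N v l)"
    if r: "crossing_recursion b N r" and v: "v \<in> N \<rightarrow> {0..1}" for r v
  proof (cases "b 0 = 0")
    \<comment> \<open>Here \<open>\<rho>\<close> and the probability of extinction are 0, so both
      sides of the equation are 0 because \<open>inverse 0 = 0\<close>; summability holds as every
      coefficient vanishes.\<close>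
    case True
    have "B_gf b 0 = 0"
      unfolding B_gf_def using True by (simp add: power_0_left if_distrib cong: if_cong)
    then have "\<rho> = 0" using \<rho> by (force simp: is_min_root_def)
    moreover have "r l = 0" if "l \<in> vecs N" for l
      using crossing_recursion_vanishes[OF r True that] .
    then have "(\<lambda>l. r l * vec_power N v l) summable_on vecs N"
      by (intro summable_on_cong[THEN iffD2, OF _ summable_on_0]) auto
    ultimately show ?thesis using crossing_pgf_eq[OF v] prob_extinct by simp
  next
    case False
    \<comment> \<open>Two different elements of \<open>N\<close> would contradict the existence of
      \<open>r\<close>, so the sum over the keys has a single term.\<close>
    then have "crossing_recursion_summed b N r"
      using crossing_recursion_imp_summed[OF r] crossing_recursion_contradictory[OF r False] by blast
    then show ?thesis by (rule summed[OF _ v])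
  qed
  then show ?thesis using summed crossing_recursion_summed_hit by blast
qed

end
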